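(* Let $(V,\circ,e)$ be a finite-dimensional Euclidean Jordan algebra over $\mathbb{R}$ with identity and rank $r$, let $\Omega$ be the interior of its cone of squares, and let $P:V\to V$ be the orthogonal projection onto a linear subspace of $V$. If the basic procedure is implemented via the Perceptron Scheme (described in the context), then one of the stopping conditions $Pz\in\Omega$ or $\|(Pz)^+\|_F\le\frac1{4r}\|z\|$ is reached after at most $(4r^2)^2=16r^4$ iterations. In the special case $V=\mathbb{R}^n$, $\Omega=\mathbb{R}^n_{++}$, with the stopping conditions in the scheme replaced by $Pz>0$ or $\|(Pz)^+\|_2\le\frac1{3\sqrt n}\|z\|_\infty$, one of these two stopping conditions is reached after at most $(3n\sqrt n)^2=9n^3$ iterations.
   Context: Euclidean Jordan algebra: $\circ:V\times V\to V$ is bilinear and commutative, $x\circ(x^2\circ y)=x^2\circ(x\circ y)$ with $x^2=x\circ x$, $x\circ e=x$, and there is an associative positive definite bilinear form on $V$. The rank $r$ is the smallest integer such that $\{e,x,\dots,x^r\}$ is linearly dependent for all $x\in V$. Every $x\in V$ has a spectral decomposition $x=\sum_{i=1}^r\lambda_i(x)c_i$ with $\{c_1,\dots,c_r\}$ a Jordan frame (non-zero primitive idempotents, $c_i\circ c_j=0$ for $i\ne j$, $\sum_i c_i=e$). Put $\mathrm{trace}(x)=\sum_i\lambda_i(x)$. $V$ carries the inner product $\langle x,y\rangle=\mathrm{trace}(x\circ y)$; $\|x\|_F=\sqrt{\langle x,x\rangle}=\|\lambda(x)\|_2$ and $\|x\|=\|\lambda(x)\|_\infty$. $\Omega=\mathrm{int}\{x^2:x\in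 V\}$, $\bar\Omega$ is its closure, and $v^+$ is the orthogonal projection of $v$ onto $\bar\Omega$, i.e. $v^+=\sum_i\max\{\lambda_i(v),0\}c_i$. The spectraplex is $\Delta(\Omega)=\{x\in\bar\Omega:\langle e,x\rangle=1\}$. For $V=\mathbb{R}^n$ the product is componentwise, so $e$ is the all-ones vector, $r=n$, $\|\cdot\|_F=\|\cdot\|_2$, $\|\cdot\|=\|\cdot\|_\infty$ and $v^+=\max(v,0)$ componentwise. Separation oracle: given $v\in V$, it either verifies $v\in\Omega$ or yields $u\in\Delta(\Omega)$ with $\langle u,v\rangle\le0$. Perceptron Scheme: pick any $z_0\in\Delta(\Omega)$ and set $t=0$. While $Pz_t\notin\Omega$ and $\|(Pz_t)^+\|_F>\frac1{4r}\|z_t\|$: pick (any) $u\in\Delta(\Omega)$ with $\langle u,Pz_t\rangle\le0$ (supplied by the separation oracle), let $z_{t+1}=\frac{t}{t+1}z_t+\frac1{t+1}u$, and increase $t$ by 1. Each execution of the loop body is one iteration. *)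

theory Defs
  imports "HOL-Analysis.Analysis"
begin

text \<open>
  The class \<open>euclidean_space\<close> only provides a nonzero finite-dimensional real vector space with its
  (unique) vector space topology, which is used for interiors and closures.  The class inner
  product is unrelated to the Jordan structure; the inner product of the Jordan algebra is the
  trace inner product \<open>jinner\<close> below.
\<close>

locale euclidean_jordan_algebra =
  fixes jp :: "'a::euclidean_space \<Rightarrow> 'a \<Rightarrow> 'a" and e :: 'a
  assumes bilinear: "bilinear jp"
    and commute: "jp x y = jp y x"
    and jordan: "jp x (jp (jp x x) y) = jp (jp x x) (jp x y)"
    and unit: "jp x e = x"
    and form: "\<exists>B :: 'a \<Rightarrow> 'a \<Rightarrow> real. bilinear B \<and> (\<forall>x. x \<noteq> 0 \<longrightarrow> B x x > 0)
                 \<and> (\<forall>x y z. B (jp x y) z = B x (jp y z))"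

primrec jpow :: "('a \<Rightarrow> 'a \<Rightarrow> 'a) \<Rightarrow> 'a \<Rightarrow> 'a \<Rightarrow> nat \<Rightarrow> 'a" where
  "jpow jp e x 0 = e"
| "jpow jp e x (Suc k) = jp x (jpow jp e x k)"

text \<open>
  Linear dependence of \<open>e, x, \<dots>, x^r\<close> is dependence as a family: the set of powers can be
  linearly independent just because powers coincide (take \<open>x = e\<close>).
\<close>

definition jrank :: "('a::real_vector \<Rightarrow> 'a \<Rightarrow> 'a) \<Rightarrow> 'a \<Rightarrow> nat" where
  "jrank jp e = (LEAST r. \<forall>x. \<exists>a :: nat \<Rightarrow> real.
     (\<exists>k\<le>r. a k \<noteq> 0) \<and> (\<Sum>k\<le>r. a k *\<^sub>R jpow jp e x k) = 0)"

definition idempotent :: "('a \<Rightarrow> 'a \<Rightarrow> 'a) \<Rightarrow> 'a \<Rightarrow> bool" where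
  "idempotent jp c \<longleftrightarrow> jp c c = c"

definition primitive_idempotent :: "('a::real_vector \<Rightarrow> 'a \<Rightarrow> 'a) \<Rightarrow> 'a \<Rightarrow> bool" where
  "primitive_idempotent jp c \<longleftrightarrow> idempotent jp c \<and> c \<noteq> 0 \<and>
     \<not> (\<exists>a b. idempotent jp a \<and> idempotent jp b \<and> a \<noteq> 0 \<and> b \<noteq> 0 \<and> c = a + b)"

text \<open>Families of length \<open>r\<close> are functions on \<open>nat\<close> of which only the values below \<open>r\<close> matter.\<close>

definition jordan_frame :: "('a::real_vector \<Rightarrow> 'a \<Rightarrow> 'a) \<Rightarrow> 'a \<Rightarrow> (nat \<Rightarrow> 'a) \<Rightarrow> bool" where
  "jordan_frame jp e c \<longleftrightarrow>
     (\<forall>i<jrank jp e. primitive_idempotent jp (c i)) \<and>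
     (\<forall>i<jrank jp e. \<forall>j<jrank jp e. i \<noteq> j \<longrightarrow> jp (c i) (c j) = 0) \<and>
     (\<Sum>i<jrank jp e. c i) = e"

definition spectral_decomposition ::
    "('a::real_vector \<Rightarrow> 'a \<Rightarrow> 'a) \<Rightarrow> 'a \<Rightarrow> 'a \<Rightarrow> (nat \<Rightarrow> real) \<Rightarrow> (nat \<Rightarrow> 'a) \<Rightarrow> bool" where
  "spectral_decomposition jp e x l c \<longleftrightarrow>
     jordan_frame jp e c \<and> x = (\<Sum>i<jrank jp e. l i *\<^sub>R c i)"

text \<open>The eigenvalues are determined up to order; every use below is symmetric in them.\<close>

definition eigenvalues :: "('a::real_vector \<Rightarrow> 'a \<Rightarrow> 'a) \<Rightarrow> 'a \<Rightarrow> 'a \<Rightarrow> nat \<Rightarrow> real" where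
  "eigenvalues jp e x = (SOME l. \<exists>c. spectral_decomposition jp e x l c)"

definition jtrace :: "('a::real_vector \<Rightarrow> 'a \<Rightarrow> 'a) \<Rightarrow> 'a \<Rightarrow> 'a \<Rightarrow> real" where
  "jtrace jp e x = (\<Sum>i<jrank jp e. eigenvalues jp e x i)"

definition jinner :: "('a::real_vector \<Rightarrow> 'a \<Rightarrow> 'a) \<Rightarrow> 'a \<Rightarrow> 'a \<Rightarrow> 'a \<Rightarrow> real" where
  "jinner jp e x y = jtrace jp e (jp x y)"

definition frob_norm :: "('a::real_vector \<Rightarrow> 'a \<Rightarrow> 'a) \<Rightarrow> 'a \<Rightarrow> 'a \<Rightarrow> real" where
  "frob_norm jp e x = sqrt (jinner jp e x x)"

definition spectral_norm :: "('a::real_vector \<Rightarrow> 'a \<Rightarrow> 'a) \<Rightarrow> 'a \<Rightarrow> 'a \<Rightarrow> real" where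
  "spectral_norm jp e x = Max ((\<lambda>i. \<bar>eigenvalues jp e x i\<bar>) ` {..<jrank jp e})"

definition symmetric_cone :: "('a::euclidean_space \<Rightarrow> 'a \<Rightarrow> 'a) \<Rightarrow> 'a set" where
  "symmetric_cone jp = interior {jp x x | x. True}"

text \<open>The orthogonal projection onto a closed convex set is the nearest point in the trace norm.\<close>

definition pos_part :: "('a::euclidean_space \<Rightarrow> 'a \<Rightarrow> 'a) \<Rightarrow> 'a \<Rightarrow> 'a \<Rightarrow> 'a" where
  "pos_part jp e v = (THE w. w \<in> closure (symmetric_cone jp) \<and>
     (\<forall>y\<in>closure (symmetric_cone jp). frob_norm jp e (v - w) \<le> frob_norm jp e (v - y)))"

definition spectraplex ::
    "('a::euclidean_space \<Rightarrow> 'a \<Rightarrow> real) \<Rightarrow> 'a \<Rightarrow> 'a set \<Rightarrow> 'a set" where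
  "spectraplex ip e \<Omega> = {x \<in> closure \<Omega>. ip e x = 1}"

definition is_orthogonal_projection ::
    "('a::real_vector \<Rightarrow> 'a \<Rightarrow> real) \<Rightarrow> 'a set \<Rightarrow> ('a \<Rightarrow> 'a) \<Rightarrow> bool" where
  "is_orthogonal_projection ip L P \<longleftrightarrow>
     subspace L \<and> (\<forall>x. P x \<in> L \<and> (\<forall>y\<in>L. ip (x - P x) y = 0))"

text \<open>
  \<open>z\<close> is a sequence of iterates of the scheme with the set \<open>\<Delta>\<close> and the stopping criterion \<open>stop\<close>,
  where any valid oracle answer \<open>u\<close> may be picked in each iteration.  Nothing is required of the
  sequence after the first iterate at which \<open>stop\<close> holds, so the least \<open>t\<close> with
  \<open>stop (z t)\<close> is the number of iterations performed.
\<close>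

definition perceptron_run ::
    "('a::real_vector \<Rightarrow> 'a \<Rightarrow> real) \<Rightarrow> 'a set \<Rightarrow> ('a \<Rightarrow> 'a) \<Rightarrow> ('a \<Rightarrow> bool) \<Rightarrow> (nat \<Rightarrow> 'a) \<Rightarrow> bool"
  where
  "perceptron_run ip \<Delta> P stop z \<longleftrightarrow> z 0 \<in> \<Delta> \<and>
     (\<forall>t. (\<forall>s\<le>t. \<not> stop (z s)) \<longrightarrow>
        (\<exists>u\<in>\<Delta>. ip u (P (z t)) \<le> 0 \<and>
           z (Suc t) = (real t / real (t + 1)) *\<^sub>R z t + (1 / real (t + 1)) *\<^sub>R u))"

definition jordan_stop ::
    "('a::euclidean_space \<Rightarrow> 'a \<Rightarrow> 'a) \<Rightarrow> 'a \<Rightarrow> ('a \<Rightarrow> 'a) \<Rightarrow> 'a \<Rightarrow> bool" where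
  "jordan_stop jp e P z \<longleftrightarrow> P z \<in> symmetric_cone jp \<or>
     frob_norm jp e (pos_part jp e (P z)) \<le> 1 / (4 * real (jrank jp e)) * spectral_norm jp e z"

definition pos_orthant :: "(real ^ 'n) set" where
  "pos_orthant = {x. \<forall>i. 0 < x $ i}"

definition orthant_stop :: "(real ^ 'n \<Rightarrow> real ^ 'n) \<Rightarrow> real ^ 'n \<Rightarrow> bool" where
  "orthant_stop P z \<longleftrightarrow> P z \<in> pos_orthant \<or>
     norm (\<chi> i. max (P z $ i) 0) \<le> 1 / (3 * sqrt (real CARD('n))) * infnorm z"

text \<open>
  The coordinatewise product of \<open>real ^ 'n\<close> with unit \<open>1\<close> (the all-ones vector) is a Euclidean
  Jordan algebra whose cone, rank, inner product, norms and positive part are those of the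
  orthant, so \<open>orthant_stop\<close> is \<open>jordan_stop\<close> of this algebra with another constant.
\<close>

lemma coordinatewise_euclidean_jordan_algebra:
  "euclidean_jordan_algebra ((*) :: real ^ 'n \<Rightarrow> real ^ 'n \<Rightarrow> real ^ 'n) 1"
proof
  show "bilinear ((*) :: real ^ 'n \<Rightarrow> real ^ 'n \<Rightarrow> real ^ 'n)"
    by (simp add: bilinear_def linear_iff vec_eq_iff algebra_simps)
  show "\<exists>B :: real ^ 'n \<Rightarrow> real ^ 'n \<Rightarrow> real. bilinear B \<and> (\<forall>x. x \<noteq> 0 \<longrightarrow> B x x > 0)
          \<and> (\<forall>x y z. B (x * y) z = B x (y * z))"
    by (rule exI[of _ "(\<bullet>)"])
      (auto simp: bilinear_conv_bounded_bilinear bounded_bilinear_inner, simp add: inner_vec_def mult.assoc)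
qed (simp_all add: vec_eq_iff)

lemma coordinatewise_symmetric_cone:
  "symmetric_cone ((*) :: real ^ 'n \<Rightarrow> real ^ 'n \<Rightarrow> real ^ 'n) = pos_orthant"
proof -
  have "{x * x | x :: real ^ 'n. True} = {y. \<forall>i. 0 \<le> y $ i}"
  proof (intro equalityI subsetI)
    fix y :: "real ^ 'n" assume "y \<in> {y. \<forall>i. 0 \<le> y $ i}"
    then have "y = (\<chi> i. sqrt (y $ i)) * (\<chi> i. sqrt (y $ i))"
      by (simp add: vec_eq_iff)
    then show "y \<in> {x * x | x. True}" by blast
  qed auto
  moreover have "interior {y :: real ^ 'n. \<forall>i. 0 \<le> y $ i} = pos_orthant"
  proof (intro interior_unique)
    show "open (pos_orthant :: (real ^ 'n) set)"
      using open_vector_box[of "\<lambda>_. {0 :: real<..}"] by (simp add: pos_orthant_def)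
    fix T :: "(real ^ 'n) set" assume T: "T \<subseteq> {y. \<forall>i. 0 \<le> y $ i}" "open T"
    show "T \<subseteq> pos_orthant"
    proof
      fix y assume y: "y \<in> T"
      then obtain d where d: "d > 0" "cball y d \<subseteq> T" using T(2) open_contains_cball by metis
      have "0 < y $ i" for i
      proof -
        have "y - d *\<^sub>R axis i 1 \<in> cball y d" using d by (simp add: dist_norm)
        then have "0 \<le> (y - d *\<^sub>R axis i 1) $ i" using d T by blast
        then show ?thesis using d by simp
      qed
      then show "y \<in> pos_orthant" by (simp add: pos_orthant_def)
    qed
  qed (auto simp: pos_orthant_def less_imp_le)
  ultimately show ?thesis by (simp add: symmetric_cone_def)
qed

lemma coordinatewise_jpow:
  "jpow (*) (1 :: real ^ 'n) x k $ i = (x $ i) ^ k"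
  by (induction k) auto

lemma coordinatewise_jrank: "jrank (*) (1 :: real ^ 'n) = CARD('n)"
  unfolding jrank_def
proof (rule Least_equality)
  show "\<forall>x :: real ^ 'n. \<exists>a :: nat \<Rightarrow> real. (\<exists>k\<le>CARD('n). a k \<noteq> 0) \<and>
          (\<Sum>k\<le>CARD('n). a k *\<^sub>R jpow (*) 1 x k) = 0"
  proof
    fix x :: "real ^ 'n"
    define p where "p = (\<Prod>j\<in>UNIV. [:- (x $ j), 1:])"
    have deg: "degree p = CARD('n)" unfolding p_def by (subst degree_prod_eq_sum_degree) auto
    have "p \<noteq> 0" by (simp add: p_def)
    then have "coeff p (CARD('n)) \<noteq> 0" using deg by (metis leading_coeff_0_iff)
    moreover have "(\<Sum>k\<le>CARD('n). coeff p k *\<^sub>R jpow (*) 1 x k) = 0"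
    proof -
      have "poly p (x $ i) = 0" for i by (auto simp: p_def poly_prod intro!: exI[of _ i])
      then show ?thesis
        by (simp add: vec_eq_iff coordinatewise_jpow poly_altdef deg)
    qed
    ultimately show "\<exists>a :: nat \<Rightarrow> real. (\<exists>k\<le>CARD('n). a k \<noteq> 0) \<and>
          (\<Sum>k\<le>CARD('n). a k *\<^sub>R jpow (*) 1 x k) = 0" by blast
  qed
next
  fix r assume r: "\<forall>x :: real ^ 'n. \<exists>a :: nat \<Rightarrow> real. (\<exists>k\<le>r. a k \<noteq> 0) \<and>
          (\<Sum>k\<le>r. a k *\<^sub>R jpow (*) 1 x k) = 0"
  obtain f :: "'n \<Rightarrow> nat" where f: "inj f" 
    by (metis finite_imp_inj_to_nat_seg finite_class.finite_UNIV)
  define x :: "real ^ 'n" where "x = (\<chi> i. real (f i))"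
  obtain a where a: "\<exists>k\<le>r. a k \<noteq> 0" "(\<Sum>k\<le>r. a k *\<^sub>R jpow (*) 1 x k) = 0" using r by blast
  define p where "p = (\<Sum>k\<le>r. monom (a k) k)"
  have co: "coeff p k = (if k \<le> r then a k else 0)" for k
    by (simp add: p_def coeff_sum)
  have deg: "degree p \<le> r" by (rule degree_le) (simp add: co)
  have nz: "p \<noteq> 0" using a(1) co by (metis coeff_0)
  have "poly p (x $ i) = (\<Sum>k\<le>r. a k *\<^sub>R jpow (*) 1 x k) $ i" for i
    by (simp add: p_def poly_sum poly_monom coordinatewise_jpow)
  then have "range (($) x) \<subseteq> {t. poly p t = 0}" using a(2) by auto
  then have "card (range (($) x)) \<le> card {t. poly p t = 0}"
    by (rule card_mono[OF poly_roots_finite[OF nz]])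
  also have "\<dots> \<le> r" using card_poly_roots_bound[OF nz] deg by (meson order_trans)
  also have "inj (($) x)" using f by (simp add: x_def inj_def)
  then have "card (range (($) x)) = CARD('n)" by (rule card_image)
  finally show "CARD('n) \<le> r" .
qed

lemma coordinatewise_spectral_decomposition:
  fixes x :: "real ^ 'n"
  assumes "spectral_decomposition (*) 1 x l c"
  shows "\<exists>s. bij_betw s UNIV {..<CARD('n)} \<and> (\<forall>i. x $ i = l (s i))"
proof -
  let ?n = "CARD('n)"
  have prim: "\<And>i. i < ?n \<Longrightarrow> primitive_idempotent (*) (c i)"
    and orth: "\<And>i j. i < ?n \<Longrightarrow> j < ?n \<Longrightarrow> i \<noteq> j \<Longrightarrow> c i * c j = 0"
    and x: "x = (\<Sum>i<?n. l i *\<^sub>R c i)"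
    using assms by (auto simp: spectral_decomposition_def jordan_frame_def coordinatewise_jrank)
  have val: "c i $ k = 0 \<or> c i $ k = 1" if "i < ?n" for i k
    using prim[OF that] unfolding primitive_idempotent_def idempotent_def vec_eq_iff by auto
  have "\<exists>k. c i $ k = 1" if "i < ?n" for i
    using prim[OF that] val[OF that] unfolding primitive_idempotent_def vec_eq_iff by auto
  then obtain g where g: "\<And>i. i < ?n \<Longrightarrow> c i $ g i = 1" by metis
  have dis: "i = j" if "i < ?n" "j < ?n" "c i $ k = 1" "c j $ k = 1" for i j k
    using orth[of i j] that unfolding vec_eq_iff times_vec_def
    by (metis mult_1 vec_lambda_beta zero_index zero_neq_one)
  have inj: "inj_on g {..<?n}" by (rule inj_onI) (use g dis in \<open>metis lessThan_iff\<close>)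
  then have bij: "bij_betw g {..<?n} UNIV"
    by (simp add: bij_betw_def card_image card_subset_eq)
  define s where "s = inv_into {..<?n} g"
  have s: "bij_betw s UNIV {..<?n}" unfolding s_def by (rule bij_betw_inv_into[OF bij])
  have sn: "s k < ?n" and gs: "g (s k) = k" for k
    using s bij by (auto simp: s_def bij_betw_def f_inv_into_f)
  have "x $ k = l (s k)" for k
  proof -
    have "c i $ k = (if i = s k then 1 else 0)" if "i < ?n" for i
    proof -
      have one: "c (s k) $ k = 1" using g[OF sn[of k]] unfolding gs .
      then have "c i $ k \<noteq> 1" if "i \<noteq> s k" using dis[OF \<open>i < ?n\<close> sn _ one] that by blast
      then show ?thesis using val[OF that, of k] one by (cases "i = s k") simp_all
    qed
    then have "x $ k = (\<Sum>i<?n. l i * (if i = s k then 1 else 0))" unfolding x by simp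
    then show ?thesis using sn[of k] by (simp add: if_distrib[of "(*) _"] cong: if_cong)
  qed
  with s show ?thesis by blast
qed

lemma coordinatewise_eigenvalues:
  fixes x :: "real ^ 'n"
  shows "\<exists>s. bij_betw s UNIV {..<CARD('n)} \<and> (\<forall>i. x $ i = eigenvalues (*) 1 x (s i))"
proof -
  let ?n = "CARD('n)"
  obtain h :: "nat \<Rightarrow> 'n" where h: "bij_betw h {..<?n} UNIV"
    using ex_bij_betw_nat_finite[of "UNIV :: 'n set"] by (auto simp: atLeast0LessThan)
  then have hi: "h i = h j \<longleftrightarrow> i = j" if "i < ?n" "j < ?n" for i j
    using that by (auto simp: bij_betw_def inj_on_def)
  define c :: "nat \<Rightarrow> real ^ 'n" where "c i = axis (h i) 1" for i
  have re: "(\<Sum>i<?n. F (h i)) = sum F UNIV" for F :: "'n \<Rightarrow> real"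
    by (rule sum.reindex_bij_betw[OF h])
  have dec: "(\<Sum>i<?n. y $ h i *\<^sub>R c i) = y" for y :: "real ^ 'n"
    unfolding vec_eq_iff
  proof
    fix k
    have "(\<Sum>i<?n. y $ h i *\<^sub>R c i) $ k = (\<Sum>i<?n. if k = h i then y $ h i else 0)"
      by (auto simp: c_def axis_def intro!: sum.cong)
    also have "\<dots> = y $ k" by (subst re) simp
    finally show "(\<Sum>i<?n. y $ h i *\<^sub>R c i) $ k = y $ k" .
  qed
  have "primitive_idempotent (*) (c i)" for i
    unfolding primitive_idempotent_def
  proof (intro conjI notI)
    assume "\<exists>a b. idempotent (*) a \<and> idempotent (*) b \<and> a \<noteq> 0 \<and> b \<noteq> 0 \<and> c i = a + b"
    then obtain a b where ab: "a * a = a" "b * b = b" "a \<noteq> 0" "b \<noteq> 0" "c i = a + b"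
      by (auto simp: idempotent_def)
    have v: "(a $ k = 0 \<or> a $ k = 1) \<and> (b $ k = 0 \<or> b $ k = 1)" for k
      using ab(1,2) by (auto simp: vec_eq_iff)
    have "a $ k = 0 \<and> b $ k = 0" if "k \<noteq> h i" for k
      using v[of k] ab(5) that by (auto simp: vec_eq_iff c_def axis_def dest: spec[of _ k])
    moreover have "a $ h i = 0 \<or> b $ h i = 0"
      using v[of "h i"] ab(5) by (auto simp: vec_eq_iff c_def axis_def dest: spec[of _ "h i"])
    ultimately show False using ab(3,4) unfolding vec_eq_iff by (metis zero_index)
  qed (auto simp: idempotent_def c_def axis_eq_0_iff, simp add: axis_def vec_eq_iff)
  moreover have "c i * c j = 0" if "i < ?n" "j < ?n" "i \<noteq> j" for i j
    using hi[OF that(1,2)] that(3) by (auto simp: c_def axis_def vec_eq_iff)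
  moreover have "(\<Sum>i<?n. c i) = 1" using dec[of 1] by simp
  ultimately have "spectral_decomposition (*) 1 x (\<lambda>i. x $ h i) c"
    by (simp add: spectral_decomposition_def jordan_frame_def coordinatewise_jrank dec)
  then have "\<exists>l c. spectral_decomposition (*) 1 x l c" by blast
  then have "\<exists>c. spectral_decomposition (*) 1 x (eigenvalues (*) 1 x) c"
    unfolding eigenvalues_def by (rule someI_ex)
  then show ?thesis using coordinatewise_spectral_decomposition by blast
qed

lemma coordinatewise_jtrace: "jtrace (*) 1 (x :: real ^ 'n) = (\<Sum>i\<in>UNIV. x $ i)"
proof -
  obtain s where s: "bij_betw s UNIV {..<CARD('n)}" "\<forall>i. x $ i = eigenvalues (*) 1 x (s i)"
    using coordinatewise_eigenvalues by blast
  show ?thesis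
    using sum.reindex_bij_betw[OF s(1), of "eigenvalues (*) 1 x"] s(2)
    by (simp add: jtrace_def coordinatewise_jrank)
qed

lemma coordinatewise_jinner: "jinner (*) (1 :: real ^ 'n) = (\<bullet>)"
  by (intro ext) (simp add: jinner_def coordinatewise_jtrace inner_vec_def)

lemma coordinatewise_frob_norm: "frob_norm (*) (1 :: real ^ 'n) = norm"
  by (intro ext) (simp add: frob_norm_def coordinatewise_jinner norm_eq_sqrt_inner)

lemma coordinatewise_spectral_norm: "spectral_norm (*) (1 :: real ^ 'n) = infnorm"
proof
  fix x :: "real ^ 'n"
  obtain s where s: "bij_betw s UNIV {..<CARD('n)}" "\<forall>i. x $ i = eigenvalues (*) 1 x (s i)"
    using coordinatewise_eigenvalues by blast
  have "(\<lambda>i. \<bar>eigenvalues (*) 1 x i\<bar>) ` {..<CARD('n)} = (\<lambda>i. \<bar>x $ i\<bar>) ` UNIV"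
    unfolding bij_betw_imp_surj_on[OF s(1), symmetric] image_image using s(2) by simp
  then show "spectral_norm (*) 1 x = infnorm x"
    by (simp add: spectral_norm_def coordinatewise_jrank infnorm_cart cSup_eq_Max full_SetCompr_eq)
qed

lemma closure_pos_orthant: "closure (pos_orthant :: (real ^ 'n) set) = {x. \<forall>i. 0 \<le> x $ i}"
proof (intro closure_unique)
  show "closed {x :: real ^ 'n. \<forall>i. 0 \<le> x $ i}"
    by (intro closed_Collect_all closed_Collect_le continuous_intros)
  fix T :: "(real ^ 'n) set" assume T: "pos_orthant \<subseteq> T" "closed T"
  show "{x. \<forall>i. 0 \<le> x $ i} \<subseteq> T"
  proof
    fix x :: "real ^ 'n" assume x: "x \<in> {x. \<forall>i. 0 \<le> x $ i}"
    have "(\<lambda>n. x + (1 / real (Suc n)) *\<^sub>R 1) \<longlonglongrightarrow> x + 0 *\<^sub>R 1"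
      by (intro tendsto_intros LIMSEQ_Suc[OF lim_1_over_n])
    moreover have "x + (1 / real (Suc n)) *\<^sub>R 1 \<in> T" for n
      using x T(1) by (auto simp: pos_orthant_def intro!: subsetD[OF T(1)] add_nonneg_pos)
    ultimately show "x \<in> T" using closed_sequentially[OF T(2)] by fastforce
  qed
qed (auto simp: pos_orthant_def less_imp_le)

lemma coordinatewise_pos_part:
  "pos_part (*) 1 (v :: real ^ 'n) = (\<chi> i. max (v $ i) 0)"
proof -
  let ?C = "{x :: real ^ 'n. \<forall>i. 0 \<le> x $ i}" and ?w = "\<chi> i. max (v $ i) 0"
  have cl: "closed ?C" using closure_pos_orthant closed_closure by metis
  have cv: "convex ?C" by (auto simp: convex_def)
  have le: "dist v ?w \<le> dist v y" if "y \<in> ?C" for y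
    unfolding dist_vec_def
  proof (rule L2_set_mono)
    fix i
    have "0 \<le> y $ i" using that by simp
    then show "dist (v $ i) (?w $ i) \<le> dist (v $ i) (y $ i)"
      by (auto simp: dist_real_def max_def)
  qed simp
  have eq: "w = ?w" if "w \<in> ?C" "\<forall>y\<in>?C. dist v w \<le> dist v y" for w
    using closest_point_unique[OF cv cl that] closest_point_unique[OF cv cl, of ?w v] le by auto
  show ?thesis
    unfolding pos_part_def coordinatewise_symmetric_cone closure_pos_orthant
      coordinatewise_frob_norm dist_norm[symmetric]
    by (rule the_equality) (use le eq in auto)
qed

end

theory Submission imports Defs begin

text \<open>
  With \<open>u\<close> the oracle answers, \<open>t\<^sup>2 \<parallel>P z\<^sub>t\<parallel>\<^sup>2\<close> grows by at most \<open>\<parallel>u\<parallel>\<^sup>2 \<le> 1\<close> per iteration, because the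
  cross term \<open>2 t \<langle>u, P z\<^sub>t\<rangle>\<close> is nonpositive; hence \<open>\<parallel>(P z\<^sub>t)\<^sup>+\<parallel> \<le> \<parallel>P z\<^sub>t\<parallel> \<le> 1 / \<surd>t\<close>, while a point of
  trace \<open>1\<close> has spectral norm at least \<open>1 / r\<close>.

  For Jordan algebras it remains to see that the trace form, which is defined through spectral
  decompositions, is an inner product, that is, that the trace is linear.  Let \<open>B\<close> be any
  associative inner product.  If \<open>c\<close> is a primitive idempotent then \<open>2 c (c v) - c v\<close> is a multiple
  of \<open>c\<close> for all \<open>v\<close>, and from this two primitive idempotents that are not \<open>B\<close>-orthogonal have equal
  \<open>B\<close>-norm.  So for any fixed frame \<open>f\<^sub>1, \<dots>, f\<^sub>r\<close> the linear functional
  \<open>T x = \<Sum>\<^sub>i B x f\<^sub>i / B f\<^sub>i f\<^sub>i\<close> satisfies \<open>T c = B c e / B c c = 1\<close> for every primitive idempotent \<open>c\<close>.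
  Hence \<open>T\<close> is the trace, and \<open>T e\<close> is the common cardinality of all frames, which is the rank.
\<close>

section \<open>Inner products and the perceptron estimate\<close>

locale inner_form =
  fixes B :: "'a::euclidean_space \<Rightarrow> 'a \<Rightarrow> real"
  assumes bilinear_form: "bilinear B"
    and form_sym: "B x y = B y x"
    and form_pos: "x \<noteq> 0 \<Longrightarrow> 0 < B x x"
begin

lemma form_add_left: "B (x + y) z = B x z + B y z"
  and form_add_right: "B x (y + z) = B x y + B x z"
  and form_diff_left: "B (x - y) z = B x z - B y z"
  and form_diff_right: "B x (y - z) = B x y - B x z"
  and form_scale_left: "B (a *\<^sub>R x) y = a * B x y"
  and form_scale_right: "B x (a *\<^sub>R y) = a * B x y"
  and form_zero_left [simp]: "B 0 x = 0"
  and form_zero_right [simp]: "B x 0 = 0"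
  by (simp_all add: bilinear_form bilinear_ladd bilinear_radd bilinear_lsub bilinear_rsub
      bilinear_lmul bilinear_rmul bilinear_lzero bilinear_rzero)

lemma form_sum_left: "B (sum f S) y = (\<Sum>i\<in>S. B (f i) y)"
  by (induction S rule: infinite_finite_induct) (simp_all add: form_add_left)

lemma form_sum_right: "B y (sum f S) = (\<Sum>i\<in>S. B y (f i))"
  by (induction S rule: infinite_finite_induct) (simp_all add: form_add_right)

lemmas form_expand = form_add_left form_add_right form_diff_left form_diff_right
  form_scale_left form_scale_right

lemma form_nonneg: "0 \<le> B x x"
  using form_pos[of x] by (cases "x = 0") auto

lemma form_eq_zero_iff [simp]: "B x x = 0 \<longleftrightarrow> x = 0"
  using form_pos[of x] by (cases "x = 0") auto

lemma continuous_on_form [continuous_intros]: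
  "continuous_on S f \<Longrightarrow> continuous_on S g \<Longrightarrow> continuous_on S (\<lambda>x. B (f x) (g x))"
  using bilinear_form unfolding bilinear_conv_bounded_bilinear
  by (rule bounded_bilinear.continuous_on)

text \<open>The minimum of \<open>B\<close> on the compact unit sphere is positive, and homogeneity
  spreads it to the whole space. This ties \<open>B\<close> to the class norm, for which compactness
  is available.\<close>

lemma form_bounded_below:
  obtains m where "0 < m" "\<And>x. m * (norm x)\<^sup>2 \<le> B x x"
proof -
  have "sphere (0::'a) 1 \<noteq> {}" by simp
  then obtain s where s: "s \<in> sphere 0 1" "\<And>y. y \<in> sphere 0 1 \<Longrightarrow> B s s \<le> B y y"
    using continuous_attains_inf[of "sphere 0 1" "\<lambda>y. B y y"] continuous_on_form[OF continuous_on_id continuous_on_id]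
    by (metis compact_sphere)
  have "B s s * (norm x)\<^sup>2 \<le> B x x" for x
  proof (cases "x = 0")
    case False
    then have "B s s \<le> B ((1 / norm x) *\<^sub>R x) ((1 / norm x) *\<^sub>R x)" by (intro s) simp
    then show ?thesis using False by (simp add: form_expand field_simps power2_eq_square)
  qed simp
  moreover have "0 < B s s" using s(1) form_pos[of s] by (cases "s = 0") auto
  ultimately show ?thesis using that by blast
qed

section \<open>Nearest points and orthogonal projection\<close>

text \<open>By \<open>form_bounded_below\<close> the points at least as near as a fixed
  \<open>y0\<close> lie in a ball of the class norm, so the minimum is taken over a compact
  set.\<close>

lemma nearest_point_exists:
  assumes "closed K" "K \<noteq> {}"
  shows "\<exists>w\<in>K. \<forall>y\<in>K. B (v - w) (v - w) \<le> B (v - y) (v - y)"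
proof -
  obtain m where m: "0 < m" "\<And>x. m * (norm x)\<^sup>2 \<le> B x x" using form_bounded_below by blast
  obtain y0 where y0: "y0 \<in> K" using assms by blast
  define R where "R = B (v - y0) (v - y0) / m"
  have R: "m * R = B (v - y0) (v - y0)" "0 \<le> R" using m(1) by (simp_all add: R_def form_nonneg)
  have near: "y \<in> cball v (sqrt R)" if "B (v - y) (v - y) \<le> B (v - y0) (v - y0)" for y
  proof -
    have "m * (norm (v - y))\<^sup>2 \<le> m * R" using m(2)[of "v - y"] that R(1) by linarith
    then have "(norm (v - y))\<^sup>2 \<le> R" using m(1) by simp
    then show ?thesis by (simp add: dist_norm real_le_rsqrt)
  qed
  have "compact (K \<inter> cball v (sqrt R))" using assms(1) by (simp add: closed_Int_compact)
  moreover have "y0 \<in> K \<inter> cball v (sqrt R)" using y0 near by blast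
  moreover have cont: "continuous_on S (\<lambda>y. v - y)" for S by (intro continuous_intros)
  ultimately obtain w where w: "w \<in> K \<inter> cball v (sqrt R)"
    "\<And>y. y \<in> K \<inter> cball v (sqrt R) \<Longrightarrow> B (v - w) (v - w) \<le> B (v - y) (v - y)"
    using continuous_attains_inf[of "K \<inter> cball v (sqrt R)" "\<lambda>y. B (v - y) (v - y)"]
      continuous_on_form[OF cont cont] by blast
  have "B (v - w) (v - w) \<le> B (v - y) (v - y)" if "y \<in> K" for y
  proof (cases "B (v - y) (v - y) \<le> B (v - y0) (v - y0)")
    case True
    then show ?thesis using w(2) near that by blast
  next
    case False
    then show ?thesis using w(2)[of y0] \<open>y0 \<in> K \<inter> _\<close> by simp
  qed
  then show ?thesis using w(1) by blast
qed

text \<open>By the parallelogram law, the midpoint of two distinct nearest points would be strictly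
  nearer.\<close>

lemma nearest_point_unique:
  assumes K: "convex K" and w: "w \<in> K" "\<forall>y\<in>K. B (v - w) (v - w) \<le> B (v - y) (v - y)"
    and w': "w' \<in> K" "\<forall>y\<in>K. B (v - w') (v - w') \<le> B (v - y) (v - y)"
  shows "w = w'"
proof -
  define m where "m = (1/2) *\<^sub>R w + (1/2) *\<^sub>R w'"
  have "m \<in> K" unfolding m_def using K w(1) w'(1) by (intro convexD) auto
  then have "B (v - w) (v - w) \<le> B (v - m) (v - m)" "B (v - w') (v - w') \<le> B (v - m) (v - m)"
    using w w' by auto
  moreover have "B (v - m) (v - m) = (B (v - w) (v - w) + B (v - w') (v - w')) / 2 - B (w - w') (w - w') / 4"
    by (simp add: m_def form_expand form_sym[of w' w] form_sym[of w v] form_sym[of w' v] field_simps)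
  moreover have "d \<le> 0" if "a \<le> c" "b \<le> c" "c = (a + b) / 2 - d / 4" for a b c d :: real
    using that by (simp add: field_simps)
  ultimately have "B (w - w') (w - w') \<le> 0" by blast
  then show ?thesis using form_pos[of "w - w'"] by (cases "w = w'") auto
qed

lemma orthogonal_projection_exists:
  assumes E: "subspace E"
  obtains x' where "x' \<in> E" "\<And>z. z \<in> E \<Longrightarrow> B (x - x') z = 0"
proof -
  obtain w where w: "w \<in> E" "\<forall>y\<in>E. B (x - w) (x - w) \<le> B (x - y) (x - y)"
    using nearest_point_exists[of E x] E closed_subspace subspace_0 by blast
  have "B (x - w) z = 0" if z: "z \<in> E" for z
  proof (cases "z = 0")
    case False
    define s where "s = B (x - w) z / B z z"
    have pos: "0 < B z z" using False by (rule form_pos)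
    have "w + s *\<^sub>R z \<in> E" using E w(1) z by (simp add: subspace_add subspace_scale)
    then have "B (x - w) (x - w) \<le> B (x - (w + s *\<^sub>R z)) (x - (w + s *\<^sub>R z))" using w by blast
    also have "\<dots> = B (x - w) (x - w) - 2 * s * B (x - w) z + s\<^sup>2 * B z z"
      by (simp add: form_expand form_sym[of z x] form_sym[of z w] power2_eq_square algebra_simps)
    also have "s\<^sup>2 * B z z = s * B (x - w) z" using pos by (simp add: s_def power2_eq_square)
    finally have "s * B (x - w) z \<le> 0" by simp
    then have "(B (x - w) z)\<^sup>2 \<le> 0" using pos by (simp add: s_def power2_eq_square divide_le_0_iff)
    then show ?thesis by simp
  qed simp
  with w(1) that show ?thesis by blast
qed

text \<open>Comparing \<open>w\<close> with its nonnegative multiples shows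
  \<open>B v w = B w w\<close>, so \<open>v - w\<close> is orthogonal to \<open>w\<close> and
  Pythagoras applies.\<close>

lemma nearest_point_cone_le:
  assumes K: "\<And>s y. 0 \<le> s \<Longrightarrow> y \<in> K \<Longrightarrow> s *\<^sub>R y \<in> K"
    and w: "w \<in> K" "\<forall>y\<in>K. B (v - w) (v - w) \<le> B (v - y) (v - y)"
  shows "B w w \<le> B v v"
proof (cases "w = 0")
  case False
  define s where "s = B v w / B w w"
  have pos: "0 < B w w" using False by (rule form_pos)
  have q: "B w w - 2 * B v w \<le> s\<^sup>2 * B w w - 2 * s * B v w" if "0 \<le> s" for s
  proof -
    have "B (v - w) (v - w) \<le> B (v - s *\<^sub>R w) (v - s *\<^sub>R w)" using K w that by blast
    then show ?thesis by (simp add: form_expand form_sym[of w v] power2_eq_square algebra_simps)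
  qed
  \<comment> \<open>The competitor \<open>0\<close> gives \<open>B w w \<le> 2 * B v w\<close>, so
    the vertex \<open>s\<close> of the quadratic is an admissible scale.\<close>
  have "0 \<le> s" unfolding s_def using q[of 0] pos by simp
  moreover have "s\<^sup>2 * B w w = B v w * B v w / B w w" "s * B v w = B v w * B v w / B w w"
    using pos by (simp_all add: s_def power2_eq_square)
  ultimately have "B w w - 2 * B v w \<le> - (B v w * B v w / B w w)"
    using q[of s] by linarith
  then have "(B w w - 2 * B v w) * B w w \<le> - (B v w * B v w / B w w) * B w w"
    by (rule mult_right_mono) (rule form_nonneg)
  then have "(B w w - B v w)\<^sup>2 \<le> 0" using False
    by (simp add: power2_eq_square algebra_simps)
  then have "B v w = B w w" by simp
  moreover have "0 \<le> B (v - w) (v - w)" by (rule form_nonneg)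
  ultimately show ?thesis by (simp add: form_expand form_sym[of w v])
qed (simp add: form_nonneg)

section \<open>Perceptron iteration under an orthogonal projection\<close>

context
  fixes L P
  assumes P: "is_orthogonal_projection B L P"
begin

lemma projection_orth:
  assumes "y \<in> L"
  shows "B (P x) y = B x y"
proof -
  have "B (x - P x) y = 0" using P assms by (simp add: is_orthogonal_projection_def)
  then show ?thesis unfolding form_diff_left by simp
qed

lemma projection_combination: "P (a *\<^sub>R x + b *\<^sub>R y) = a *\<^sub>R P x + b *\<^sub>R P y"
proof -
  let ?d = "P (a *\<^sub>R x + b *\<^sub>R y) - (a *\<^sub>R P x + b *\<^sub>R P y)"
  have "?d \<in> L" using P
    by (simp add: is_orthogonal_projection_def subspace_add subspace_diff subspace_scale)
  then have "B ?d ?d = 0"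
    using projection_orth[of ?d] by (simp add: form_diff_left form_add_left form_scale_left)
  then show ?thesis by simp
qed

lemma projection_le: "B (P x) (P x) \<le> B x x"
proof -
  have "P x \<in> L" using P by (simp add: is_orthogonal_projection_def)
  then have "B (x - P x) (x - P x) = B x x - B (P x) (P x)"
    using projection_orth[of "P x" x] by (simp add: form_expand form_sym[of "P x" x])
  then show ?thesis using form_nonneg[of "x - P x"] by simp
qed

text \<open>Scaling by the square of \<open>t\<close> makes the estimate trivial at
  \<open>t = 0\<close> and turns the averages into plain sums. Only the iterates before
  \<open>t\<close> must be unfinished, so \<open>z t\<close> itself may already satisfy
  \<open>stop\<close>.\<close>

lemma perceptron_progress:
  assumes run: "perceptron_run B \<Delta> P stop z" and small: "\<And>u. u \<in> \<Delta> \<Longrightarrow> B u u \<le> 1"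
    and conv: "convex \<Delta>" and "\<And>s. s < t \<Longrightarrow> \<not> stop (z s)"
  shows "z t \<in> \<Delta> \<and> (real t)\<^sup>2 * B (P (z t)) (P (z t)) \<le> real t"
  using assms(4)
proof (induction t)
  case 0
  have "z 0 \<in> \<Delta>" using run unfolding perceptron_run_def by blast
  then show ?case by simp
next
  case (Suc t)
  then have IH: "z t \<in> \<Delta>" "(real t)\<^sup>2 * B (P (z t)) (P (z t)) \<le> real t" by auto
  have "\<forall>s\<le>t. \<not> stop (z s)" using Suc.prems by auto
  then obtain u where u: "u \<in> \<Delta>" "B u (P (z t)) \<le> 0"
    and zt: "z (Suc t) = (real t / real (t + 1)) *\<^sub>R z t + (1 / real (t + 1)) *\<^sub>R u"
    using run unfolding perceptron_run_def by blast
  have "z (Suc t) \<in> \<Delta>" unfolding zt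
    using conv IH(1) u(1) by (intro convexD) (auto simp: field_simps)
  have "real (Suc t) *\<^sub>R P (z (Suc t)) = real t *\<^sub>R P (z t) + P u"
    unfolding zt projection_combination by (simp add: scaleR_add_right)
  moreover have "(real (Suc t))\<^sup>2 * B (P (z (Suc t))) (P (z (Suc t)))
      = B (real (Suc t) *\<^sub>R P (z (Suc t))) (real (Suc t) *\<^sub>R P (z (Suc t)))"
    by (simp only: form_scale_left form_scale_right power2_eq_square mult.assoc)
  ultimately have "(real (Suc t))\<^sup>2 * B (P (z (Suc t))) (P (z (Suc t)))
      = B (real t *\<^sub>R P (z t) + P u) (real t *\<^sub>R P (z t) + P u)"
    by simp
  also have "\<dots> = (real t)\<^sup>2 * B (P (z t)) (P (z t)) + 2 * real t * B (P u) (P (z t)) + B (P u) (P u)"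
    by (simp add: form_expand form_sym[of "P (z t)" "P u"] power2_eq_square algebra_simps)
  also have "\<dots> \<le> real t + 0 + 1"
  proof (intro add_mono IH)
    \<comment> \<open>Since \<open>P (z t)\<close> lies in \<open>L\<close>, the projection of
      \<open>u\<close> may be replaced by \<open>u\<close>, and the oracle inequality
      applies.\<close>
    have "B (P u) (P (z t)) \<le> 0"
      using u(2) P projection_orth[of "P (z t)" u] by (simp add: is_orthogonal_projection_def)
    then show "2 * real t * B (P u) (P (z t)) \<le> 0" by (simp add: mult_nonneg_nonpos)
    show "B (P u) (P u) \<le> 1" using projection_le small u(1) order_trans by blast
  qed
  finally show ?case using \<open>z (Suc t) \<in> \<Delta>\<close> by simp
qed

end
end

section \<open>Power associativity of Jordan algebras\<close>

lemma double_eq_zero: "a + a = 0 \<Longrightarrow> a = (0 :: 'a :: real_vector)"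
  by (metis scaleR_2 scaleR_eq_0_iff zero_neq_numeral)

context euclidean_jordan_algebra
begin

notation jp (infixl "\<odot>" 70)

lemma jp_add_left: "(x + y) \<odot> z = x \<odot> z + y \<odot> z"
  and jp_add_right: "x \<odot> (y + z) = x \<odot> y + x \<odot> z"
  and jp_diff_left: "(x - y) \<odot> z = x \<odot> z - y \<odot> z"
  and jp_diff_right: "x \<odot> (y - z) = x \<odot> y - x \<odot> z"
  and jp_scale_left: "(a *\<^sub>R x) \<odot> y = a *\<^sub>R (x \<odot> y)"
  and jp_scale_right: "x \<odot> (a *\<^sub>R y) = a *\<^sub>R (x \<odot> y)"
  and jp_zero_left [simp]: "0 \<odot> x = 0"
  and jp_zero_right [simp]: "x \<odot> 0 = 0"
  by (simp_all add: bilinear bilinear_ladd bilinear_radd bilinear_lsub bilinear_rsub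
      bilinear_lmul bilinear_rmul bilinear_lzero bilinear_rzero)

lemma jp_sum_left: "sum f S \<odot> y = (\<Sum>i\<in>S. f i \<odot> y)"
  by (induction S rule: infinite_finite_induct) (simp_all add: jp_add_left)

lemma jp_sum_right: "y \<odot> sum f S = (\<Sum>i\<in>S. y \<odot> f i)"
  by (induction S rule: infinite_finite_induct) (simp_all add: jp_add_right)

lemmas jp_expand = jp_add_left jp_add_right jp_diff_left jp_diff_right jp_scale_left jp_scale_right

lemma jp_unit_left [simp]: "e \<odot> x = x"
  using unit commute by metis

text \<open>The Jordan identity \<open>J u = 0\<close> is cubic in \<open>u\<close>. The part of
  \<open>J (x + z)\<close> linear in \<open>z\<close> is isolated by taking the odd part in
  \<open>z\<close> and removing the cubic term \<open>J z\<close>.\<close>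

lemma jordan_linearised:
  "z \<odot> (x \<odot> x \<odot> y) + 2 *\<^sub>R (x \<odot> (x \<odot> z \<odot> y)) = 2 *\<^sub>R (x \<odot> z \<odot> (x \<odot> y)) + x \<odot> x \<odot> (z \<odot> y)"
proof -
  define D where "D = z \<odot> (x \<odot> x \<odot> y) + 2 *\<^sub>R (x \<odot> (x \<odot> z \<odot> y))
    - (2 *\<^sub>R (x \<odot> z \<odot> (x \<odot> y)) + x \<odot> x \<odot> (z \<odot> y))"
  define J where "J u = u \<odot> (u \<odot> u \<odot> y) - u \<odot> u \<odot> (u \<odot> y)" for u
  have "J u = 0" for u by (simp add: J_def jordan)
  moreover have "D + D = J (x + z) - J (x - z) - J z - J z"
    unfolding D_def J_def
    by (simp add: jp_expand commute[of z x] scaleR_2 algebra_simps)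
  ultimately show ?thesis using double_eq_zero[of D] by (simp add: D_def)
qed

text \<open>The linearised identity is quadratic in \<open>x\<close> and is polarised once
  more.\<close>

lemma jordan_polarised:
  "z \<odot> (x \<odot> w \<odot> y) + x \<odot> (w \<odot> z \<odot> y) + w \<odot> (x \<odot> z \<odot> y)
   = x \<odot> z \<odot> (w \<odot> y) + w \<odot> z \<odot> (x \<odot> y) + x \<odot> w \<odot> (z \<odot> y)"
proof -
  define D where "D = z \<odot> (x \<odot> w \<odot> y) + x \<odot> (w \<odot> z \<odot> y) + w \<odot> (x \<odot> z \<odot> y)
    - (x \<odot> z \<odot> (w \<odot> y) + w \<odot> z \<odot> (x \<odot> y) + x \<odot> w \<odot> (z \<odot> y))"
  define J where "J u = z \<odot> (u \<odot> u \<odot> y) + 2 *\<^sub>R (u \<odot> (u \<odot> z \<odot> y))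
    - (2 *\<^sub>R (u \<odot> z \<odot> (u \<odot> y)) + u \<odot> u \<odot> (z \<odot> y))" for u
  have "J u = 0" for u by (simp add: J_def jordan_linearised)
  moreover have "D + D = J (x + w) - J x - J w"
    unfolding D_def J_def
    by (simp add: jp_expand commute[of w x] scaleR_2 algebra_simps)
  ultimately show ?thesis using double_eq_zero[of D] by (simp add: D_def)
qed

text \<open>The right side of \<open>jordan_polarised\<close>, with \<open>v\<close> for
  \<open>z\<close>, is unchanged when \<open>y\<close> and \<open>v\<close> are exchanged, so the
  two left sides agree. This writes multiplication by a triple product through multiplications by
  its factors and their pairwise products.\<close>

lemma jp_triple_operator:
  "(y \<odot> (x \<odot> w)) \<odot> v = y \<odot> (x \<odot> w \<odot> v) + x \<odot> (w \<odot> y \<odot> v) + w \<odot> (x \<odot> y \<odot> v)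
     - x \<odot> (y \<odot> (w \<odot> v)) - w \<odot> (y \<odot> (x \<odot> v))"
proof -
  have "v \<odot> (x \<odot> w \<odot> y) + x \<odot> (w \<odot> v \<odot> y) + w \<odot> (x \<odot> v \<odot> y)
      = y \<odot> (x \<odot> w \<odot> v) + x \<odot> (w \<odot> y \<odot> v) + w \<odot> (x \<odot> y \<odot> v)"
    using jordan_polarised[of v x w y] jordan_polarised[of y x w v]
    by (simp add: commute algebra_simps)
  then show ?thesis
    by (simp add: algebra_simps commute[of v] commute[of _ y])
qed

text \<open>Multiplication by the power \<open>m + 2\<close> is built from multiplications by
  \<open>x\<close>, by \<open>x \<odot> x\<close> and by the powers \<open>m\<close> and
  \<open>m + 1\<close>. All of these commute with multiplication by \<open>x\<close>, by
  \<open>jordan\<close> and induction.\<close>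

lemma jpow_operator_commute: "x \<odot> (jpow jp e x n \<odot> v) = jpow jp e x n \<odot> (x \<odot> v)"
proof (induction n arbitrary: v rule: less_induct)
  case (less n)
  consider "n = 0" | "n = 1" | m where "n = Suc (Suc m)" by (metis One_nat_def not0_implies_Suc)
  then show ?case
  proof cases
    case 3
    let ?p = "jpow jp e x m"
    have 1: "x \<odot> (?p \<odot> v) = ?p \<odot> (x \<odot> v)" "x \<odot> (x \<odot> ?p \<odot> v) = x \<odot> ?p \<odot> (x \<odot> v)" for v
      using less[of m] less[of "Suc m"] 3 by simp_all
    have "jpow jp e x n \<odot> v = 2 *\<^sub>R (x \<odot> (x \<odot> ?p \<odot> v)) + ?p \<odot> (x \<odot> x \<odot> v) - 2 *\<^sub>R (x \<odot> (x \<odot> (?p \<odot> v)))" for v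
      using jp_triple_operator[of x x ?p v] 3 by (simp add: 1 commute[of ?p x] scaleR_2)
    then show ?thesis
      by (simp add: jp_expand 1 jordan)
  qed (simp_all add: unit)
qed

lemma jpow_add: "jpow jp e x m \<odot> jpow jp e x n = jpow jp e x (m + n)"
proof (induction n)
  case (Suc n)
  then show ?case using jpow_operator_commute[of x m "jpow jp e x n"] by simp
qed (simp add: unit)

text \<open>The zeroth power is left out so that an idempotent \<open>c\<close> with
  \<open>c \<odot> y = y\<close> acts as a unit on all of \<open>powers_span y\<close>. The unit
  \<open>e\<close> may then be missing; \<open>spectral_theorem_unit\<close> deals with
  that.\<close>

definition powers_span :: "'a \<Rightarrow> 'a set" where
  "powers_span x = span (range (\<lambda>k. jpow jp e x (Suc k)))"

lemma powers_span_closed: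
  assumes "a \<in> powers_span x" "b \<in> powers_span x"
  shows "a \<odot> b \<in> powers_span x"
proof -
  let ?S = "range (\<lambda>k. jpow jp e x (Suc k))"
  have pw: "jpow jp e x (Suc k) \<odot> jpow jp e x (Suc l) \<in> span ?S" for k l
    using jpow_add[of x "Suc k" "Suc l"] by (metis add_Suc rangeI span_base)
  have 1: "jpow jp e x (Suc k) \<odot> b \<in> span ?S" for k
    using assms(2) unfolding powers_span_def
    by (rule span_induct)
      (auto simp: pw subspace_def jp_expand span_add span_scale span_zero simp del: jpow.simps)
  show ?thesis
    using assms(1) unfolding powers_span_def
    by (rule span_induct)
      (auto simp: 1 subspace_def jp_expand span_add span_scale span_zero simp del: jpow.simps)
qed

lemma powers_span_assoc:
  assumes "a \<in> powers_span x" "b \<in> powers_span x" "c \<in> powers_span x"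
  shows "a \<odot> b \<odot> c = a \<odot> (b \<odot> c)"
proof -
  let ?S = "range (\<lambda>k. jpow jp e x (Suc k))"
  have 1: "p \<odot> q \<odot> s = p \<odot> (q \<odot> s)" if "p \<in> ?S" "q \<in> ?S" "s \<in> ?S" for p q s
    using that by (auto simp del: jpow.simps simp: jpow_add add.assoc)
  have 2: "p \<odot> q \<odot> c = p \<odot> (q \<odot> c)" if "p \<in> ?S" "q \<in> ?S" for p q
    using assms(3) unfolding powers_span_def
    by (rule span_induct) (auto simp: 1[OF that] subspace_def jp_expand)
  have 3: "p \<odot> b \<odot> c = p \<odot> (b \<odot> c)" if "p \<in> ?S" for p
    using assms(2) unfolding powers_span_def
    by (rule span_induct) (auto simp: 2[OF that] subspace_def jp_expand)
  show ?thesis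
    using assms(1) unfolding powers_span_def
    by (rule span_induct) (auto simp: 3 subspace_def jp_expand)
qed

lemma powers_span_self: "x \<in> powers_span x"
proof -
  have "x = jpow jp e x (Suc 0)" by (simp add: unit)
  then show ?thesis unfolding powers_span_def by (metis rangeI span_base)
qed

lemma subspace_powers_span: "subspace (powers_span x)"
  by (simp add: powers_span_def)

text \<open>\<open>jordan_linearised\<close> at the idempotent \<open>c\<close> makes the
  multiplications by \<open>c\<close> and \<open>y\<close> commute, so \<open>c\<close> passes
  through every power of \<open>y\<close>.\<close>

lemma powers_span_peirce_one:
  assumes c: "c \<odot> c = c" and y: "c \<odot> y = y" and a: "a \<in> powers_span y"
  shows "c \<odot> a = a"
proof -
  have "c \<odot> (y \<odot> v) = y \<odot> (c \<odot> v)" for v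
    using jordan_linearised[of y c v] by (simp add: c y scaleR_2)
  then have "c \<odot> jpow jp e y (Suc k) = jpow jp e y (Suc k)" for k
    by (induction k) (simp_all add: unit y)
  then show ?thesis
    using a unfolding powers_span_def
    by - (erule span_induct, auto simp: subspace_def jp_expand simp del: jpow.simps)
qed

end

section \<open>The spectral theorem\<close>

text \<open>The axiom \<open>form\<close> only asserts existence; here one such form gets a name. It
  need not be the trace form, whose bilinearity is proved only later.\<close>

locale form_jordan_algebra = euclidean_jordan_algebra jp e
  for jp :: "'a::euclidean_space \<Rightarrow> 'a \<Rightarrow> 'a" and e :: 'a +
  fixes B :: "'a \<Rightarrow> 'a \<Rightarrow> real"
  assumes B_bilinear: "bilinear B"
    and B_pos: "x \<noteq> 0 \<Longrightarrow> 0 < B x x"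
    and B_assoc: "B (jp x y) z = B x (jp y z)"
begin

sublocale inner_form B
proof
  show "B x y = B y x" for x y
    using B_assoc[of x y e] B_assoc[of y x e] by (simp add: unit commute)
qed (use B_bilinear B_pos in auto)

lemma self_adjoint: "B (x \<odot> y) z = B y (x \<odot> z)"
  using B_assoc[of y x z] by (simp add: commute)

lemma square_eq_zero: "x \<odot> x = 0 \<Longrightarrow> x = 0"
  using B_assoc[of x x e] by (simp add: unit)

definition orth_idempotents :: "'a set \<Rightarrow> bool" where
  "orth_idempotents S \<longleftrightarrow> finite S \<and> (\<forall>c\<in>S. c \<odot> c = c \<and> c \<noteq> 0) \<and>
     (\<forall>c\<in>S. \<forall>d\<in>S. c \<noteq> d \<longrightarrow> c \<odot> d = 0)"

text \<open>A maximiser of the Rayleigh quotient is an eigenvector.\<close>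

lemma eigenvector_exists:
  assumes A: "subspace A" "A \<noteq> {0}" and inv: "\<And>y. y \<in> A \<Longrightarrow> x \<odot> y \<in> A"
  obtains y l where "y \<in> A" "y \<noteq> 0" "x \<odot> y = l *\<^sub>R y"
proof -
  let ?K = "A \<inter> sphere 0 1"
  define F where "F v = B (x \<odot> v) v / B v v" for v
  have "compact ?K" using A(1) by (simp add: closed_Int_compact closed_subspace)
  moreover obtain v0 where v0: "v0 \<in> A" "v0 \<noteq> 0" using A subspace_0 by blast
  then have "(1 / norm v0) *\<^sub>R v0 \<in> ?K" using A(1) by (simp add: subspace_scale)
  moreover have "continuous_on ?K F"
  proof -
    have "continuous_on ?K (\<lambda>v. x \<odot> v)"
      using bilinear unfolding bilinear_conv_bounded_bilinear
      by (rule bounded_bilinear.continuous_on) (intro continuous_intros)+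
    then show ?thesis unfolding F_def
      by (intro continuous_intros) auto
  qed
  ultimately obtain y where y: "y \<in> ?K" "\<forall>v\<in>?K. F v \<le> F y"
    using continuous_attains_sup[of ?K F] by blast
  have y0: "y \<noteq> 0" and yA: "y \<in> A" using y(1) by auto
  have max: "B (x \<odot> v) v \<le> F y * B v v" if "v \<in> A" for v
  proof (cases "v = 0")
    case False
    then have "(1 / norm v) *\<^sub>R v \<in> ?K" using A(1) that by (simp add: subspace_scale)
    then have "F ((1 / norm v) *\<^sub>R v) \<le> F y" using y by blast
    moreover have "F ((1 / norm v) *\<^sub>R v) = F v"
      using False by (simp add: F_def jp_expand form_expand)
    ultimately have "B (x \<odot> v) v / B v v \<le> F y" unfolding F_def[of v, symmetric] by simp
    then show ?thesis using form_pos[OF False] by (simp add: pos_divide_le_eq)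
  qed simp
  \<comment> \<open>\<open>Q\<close> is the form of \<open>F y\<close> minus multiplication by
    \<open>x\<close>. It is nonnegative on \<open>A\<close> and vanishes at \<open>y\<close>, so the
    residual \<open>d\<close> must be zero: otherwise a short move from \<open>y\<close> along
    \<open>- d\<close> would make \<open>Q\<close> negative.\<close>
  define Q where "Q u v = F y * B u v - B (x \<odot> u) v" for u v
  have Qy: "Q y y = 0" using form_pos[OF y0] by (simp add: Q_def F_def)
  have Qpos: "0 \<le> Q v v" if "v \<in> A" for v using max[OF that] by (simp add: Q_def)
  define d where "d = F y *\<^sub>R y - x \<odot> y"
  have dA: "d \<in> A" using A(1) yA inv by (simp add: d_def subspace_diff subspace_scale)
  have Qyd: "Q y d = B d d" using form_sym[of "x \<odot> y" y]
    by (simp add: Q_def d_def form_expand)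
  have Qdy: "Q d y = Q y d"
    unfolding Q_def using self_adjoint[of x d y] form_sym[of d y] form_sym[of d "x \<odot> y"] by simp
  have quad: "0 \<le> - 2 * s * B d d + s\<^sup>2 * Q d d" for s
  proof -
    have "y - s *\<^sub>R d \<in> A" using A(1) yA dA by (simp add: subspace_diff subspace_scale)
    then have "0 \<le> Q (y - s *\<^sub>R d) (y - s *\<^sub>R d)" by (rule Qpos)
    also have "\<dots> = Q y y - s * Q y d - s * Q d y + s\<^sup>2 * Q d d"
      unfolding Q_def by (simp add: jp_expand form_expand power2_eq_square algebra_simps)
    finally show ?thesis by (simp add: Qy Qyd Qdy)
  qed
  have "B d d \<le> 0"
  proof (rule ccontr)
    assume "\<not> B d d \<le> 0"
    then have pos: "0 < B d d" by simp
    \<comment> \<open>Small enough for the linear term to dominate; the \<open>+ 1\<close> keeps the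
      denominator positive when \<open>Q d d = 0\<close>.\<close>
    define s where "s = B d d / (Q d d + 1)"
    have "0 < Q d d + 1" using Qpos[OF dA] by simp
    then have s: "0 < s" "s * (Q d d + 1) = B d d" using pos by (simp_all add: s_def)
    have "0 \<le> s * (- 2 * B d d + s * Q d d)" using quad[of s] by (simp add: power2_eq_square algebra_simps)
    then have "2 * B d d \<le> s * Q d d" using s(1) by (simp add: zero_le_mult_iff)
    also have "\<dots> \<le> B d d" using s by (simp add: distrib_left)
    finally show False using pos by simp
  qed
  then have "d = 0" using form_pos[of d] by (cases "d = 0") auto
  then have "x \<odot> y = F y *\<^sub>R y" by (simp add: d_def)
  with yA y0 that show ?thesis by blast
qed

text \<open>Split off the eigenspace \<open>E\<close> of an eigenvector.  It is an ideal of the associative algebra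
  \<open>A\<close>, and the component of \<open>x\<close> in \<open>E\<close> is a multiple of the unit of \<open>E\<close>.\<close>

lemma associative_spectral:
  assumes "subspace A" "\<And>a b. a \<in> A \<Longrightarrow> b \<in> A \<Longrightarrow> a \<odot> b \<in> A"
    and "\<And>a b c. a \<in> A \<Longrightarrow> b \<in> A \<Longrightarrow> c \<in> A \<Longrightarrow> a \<odot> b \<odot> c = a \<odot> (b \<odot> c)"
    and "x \<in> A"
  shows "\<exists>S l. orth_idempotents S \<and> S \<subseteq> A \<and> x = (\<Sum>c\<in>S. l c *\<^sub>R c)"
  using assms
proof (induction "dim A" arbitrary: A x rule: less_induct)
  case less
  note sub = less.prems(1) and mult = less.prems(2) and assoc = less.prems(3) and x = less.prems(4)
  show ?case
  proof (cases "A = {0}")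
    case True
    then show ?thesis using x
      by (intro exI[of _ "{}"]) (auto simp: orth_idempotents_def)
  next
    case False
    obtain y l where y: "y \<in> A" "y \<noteq> 0" "x \<odot> y = l *\<^sub>R y"
      using eigenvector_exists[OF sub False] mult x by blast
    define E where "E = {z \<in> A. x \<odot> z = l *\<^sub>R z}"
    define N where "N = {v \<in> A. \<forall>z\<in>E. B v z = 0}"
    have E: "subspace E" using sub
      by (auto simp: E_def subspace_def jp_expand scaleR_add_right)
    have N: "subspace N" using sub
      by (auto simp: N_def subspace_def form_expand)
    have EA: "a \<in> A" if "a \<in> E" for a using that by (simp add: E_def)
    have NA: "a \<in> A" if "a \<in> N" for a using that by (simp add: N_def)
    have ideal: "z \<odot> w \<in> E" if "z \<in> E" "w \<in> A" for z w
      using that mult assoc[of x z w] x by (simp add: E_def jp_expand)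
    have idealN: "v \<odot> w \<in> N" if "v \<in> N" "w \<in> A" for v w
      using that mult ideal commute unfolding N_def by (auto simp: B_assoc)
    have disj: "v = 0" if "v \<in> E" "v \<in> N" for v
      using that by (auto simp: N_def)
    \<comment> \<open>Both \<open>E\<close> and \<open>N\<close> are ideals of \<open>A\<close>, so
      the product lies in their intersection.\<close>
    have EN: "z \<odot> v = 0" if "z \<in> E" "v \<in> N" for z v
      using ideal[OF that(1) NA[OF that(2)]] idealN[OF that(2) EA[OF that(1)]] disj commute by metis
    obtain x1 where x1: "x1 \<in> E" "\<And>z. z \<in> E \<Longrightarrow> B (x - x1) z = 0"
      using orthogonal_projection_exists[OF E] by blast
    have x2: "x - x1 \<in> N" using x1 x EA sub by (simp add: N_def subspace_diff)
    have "y \<in> E" using y by (simp add: E_def)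
    then have "y \<notin> N" using disj y(2) by blast
    then have "N \<subset> A" using y(1) NA by blast
    then have "dim N < dim A"
      using sub N by (metis dim_psubset span_eq_iff)
    then obtain S m where S: "orth_idempotents S" "S \<subseteq> N" "x - x1 = (\<Sum>c\<in>S. m c *\<^sub>R c)"
      using less.hyps[OF _ N _ _ x2] idealN NA assoc by (metis (no_types, lifting))
    \<comment> \<open>As \<open>x - x1\<close> annihilates \<open>x1\<close>, the square of
      \<open>x1\<close> is \<open>x \<odot> x1\<close>, a multiple of \<open>x1\<close>; rescaling
      will give an idempotent unless \<open>x1 = 0\<close>.\<close>
    have "(x - x1) \<odot> x1 = 0" using EN[OF x1(1) x2] by (simp add: commute)
    then have sq: "x1 \<odot> x1 = l *\<^sub>R x1" using x1(1) by (simp add: jp_expand E_def)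
    show ?thesis
    proof (cases "x1 = 0")
      case True
      then have "x = (\<Sum>c\<in>S. m c *\<^sub>R c)" using S(3) by simp
      moreover have "S \<subseteq> A" using S(2) NA by blast
      ultimately show ?thesis using S(1) by blast
    next
      case False
      then have "l \<noteq> 0" using sq square_eq_zero[of x1] by (metis scaleR_zero_left)
      define c where "c = (1 / l) *\<^sub>R x1"
      have c: "c \<odot> c = c" "c \<noteq> 0" "c \<in> E" "x1 = l *\<^sub>R c"
        using sq \<open>l \<noteq> 0\<close> False E x1(1) by (simp_all add: c_def jp_expand subspace_scale)
      have cS: "c \<odot> s = 0" "s \<odot> c = 0" if "s \<in> S" for s
        using EN[OF c(3)] that S(2) commute by (metis subsetD)+
      then have "c \<notin> S" using c by auto
      moreover have "finite S" using S(1) by (simp add: orth_idempotents_def)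
      ultimately have "(\<Sum>d\<in>insert c S. (m(c := l)) d *\<^sub>R d) = l *\<^sub>R c + (\<Sum>d\<in>S. m d *\<^sub>R d)"
        by (auto intro!: sum.cong)
      then have "x = (\<Sum>d\<in>insert c S. (m(c := l)) d *\<^sub>R d)"
        using S(3) c(4) by (metis add_diff_cancel_left' diff_add_cancel add.commute)
      moreover have "orth_idempotents (insert c S)"
        using S(1) c cS by (auto simp: orth_idempotents_def)
      moreover have "insert c S \<subseteq> A" using c(3) EA NA S(2) by auto
      ultimately show ?thesis by blast
    qed
  qed
qed

lemma spectral_theorem_powers:
  "\<exists>S l. orth_idempotents S \<and> S \<subseteq> powers_span x \<and> x = (\<Sum>c\<in>S. l c *\<^sub>R c)"
  using subspace_powers_span powers_span_closed powers_span_assoc powers_span_self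
  by (rule associative_spectral)

section \<open>Peirce theory of an idempotent\<close>

text \<open>All three factors in \<open>jp_triple_operator\<close> are \<open>c\<close>. The
  resulting polynomial in multiplication by \<open>c\<close> has the roots \<open>0\<close>,
  \<open>1/2\<close> and \<open>1\<close>, the Peirce eigenvalues.\<close>

lemma idempotent_peirce:
  assumes "c \<odot> c = c"
  shows "2 *\<^sub>R (c \<odot> (c \<odot> (c \<odot> v))) = 3 *\<^sub>R (c \<odot> (c \<odot> v)) - c \<odot> v"
proof -
  have "c \<odot> v = c \<odot> (c \<odot> v) + c \<odot> (c \<odot> v) + c \<odot> (c \<odot> v)
      - c \<odot> (c \<odot> (c \<odot> v)) - c \<odot> (c \<odot> (c \<odot> v))"
    using jp_triple_operator[of c c c v] assms by simp
  moreover have "3 *\<^sub>R w = w + w + w" for w :: 'a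
    using scaleR_left_distrib[of 2 1 w] by (simp add: scaleR_2)
  ultimately show ?thesis by (simp add: scaleR_2 algebra_simps)
qed

text \<open>Modulo the Peirce polynomial \<open>2 L\<^sup>3 - 3 L\<^sup>2 + L\<close> of an idempotent, \<open>L = L\<^sup>2 + 4 (L - L\<^sup>2)\<^sup>2\<close>.\<close>

lemma idempotent_form:
  assumes c: "c \<odot> c = c"
  shows "B (c \<odot> v) v = B (c \<odot> v) (c \<odot> v)
    + 4 * B (c \<odot> v - c \<odot> (c \<odot> v)) (c \<odot> v - c \<odot> (c \<odot> v))"
proof -
  define v1 v2 v3 where "v1 = c \<odot> v" and "v2 = c \<odot> v1" and "v3 = c \<odot> v2"
  note defs = v1_def v2_def v3_def
  have p: "2 *\<^sub>R v3 = 3 *\<^sub>R v2 - v1" unfolding defs by (rule idempotent_peirce[OF c])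
  have p': "2 * B u v3 = 3 * B u v2 - B u v1" for u
    using arg_cong[OF p, of "B u"] by (simp add: form_expand)
  have "B v1 v2 = B v v3" "B v2 v2 = B v1 v3" "B v1 v1 = B v v2" "B v1 v = B v v1"
    using self_adjoint[of c v v2] self_adjoint[of c v1 v2] self_adjoint[of c v v1] form_sym[of v1 v]
    by (simp_all add: defs[symmetric])
  then have "B v1 v = B v1 v1 + 4 * B (v1 - v2) (v1 - v2)"
    using p'[of v] p'[of v1] form_sym[of v2 v1] by (simp add: form_expand)
  then show ?thesis by (simp add: defs)
qed

lemma idempotent_form_nonneg: "c \<odot> c = c \<Longrightarrow> 0 \<le> B (c \<odot> v) v"
  by (simp add: idempotent_form form_nonneg)

lemma idempotent_form_zero:
  assumes "c \<odot> c = c" "B (c \<odot> v) v = 0"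
  shows "c \<odot> v = 0"
proof -
  have "B (c \<odot> v) (c \<odot> v) \<le> 0"
    using idempotent_form[OF assms(1), of v] assms(2)
      form_nonneg[of "c \<odot> v - c \<odot> (c \<odot> v)"] by linarith
  then show ?thesis using form_pos[of "c \<odot> v"] by (cases "c \<odot> v = 0") auto
qed

lemma idempotents_sum_orth:
  assumes "a \<odot> a = a" "b \<odot> b = b" "(a + b) \<odot> (a + b) = a + b"
  shows "a \<odot> b = 0"
proof -
  have "a \<odot> b + a \<odot> b = 0"
    using assms by (simp add: jp_expand commute[of b a])
  then show ?thesis by (rule double_eq_zero)
qed

text \<open>The numbers \<open>B (a \<odot> d) d\<close> and \<open>B (b \<odot> d) d\<close> are
  nonnegative and add up to zero. This keeps the pieces of a split idempotent orthogonal to the rest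
  of a frame.\<close>

lemma orth_summand:
  assumes "a \<odot> a = a" "b \<odot> b = b" "(a + b) \<odot> d = 0"
  shows "a \<odot> d = 0"
proof -
  have "B (a \<odot> d) d + B (b \<odot> d) d = 0"
    using arg_cong[OF assms(3), of "\<lambda>u. B u d"] by (simp add: jp_expand form_expand)
  then have "B (a \<odot> d) d = 0"
    using idempotent_form_nonneg[OF assms(1), of d] idempotent_form_nonneg[OF assms(2), of d] by linarith
  then show ?thesis by (rule idempotent_form_zero[OF assms(1)])
qed

lemma orth_sum_mult:
  assumes S: "orth_idempotents S" and d: "d \<in> S"
  shows "(\<Sum>c\<in>S. l c *\<^sub>R c) \<odot> d = l d *\<^sub>R d"
proof -
  have "(\<Sum>c\<in>S. l c *\<^sub>R c) \<odot> d = (\<Sum>c\<in>S. if c = d then l d *\<^sub>R d else 0)"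
    unfolding jp_sum_left using S d
    by (intro sum.cong) (auto simp: orth_idempotents_def jp_expand)
  then show ?thesis using S d by (simp add: orth_idempotents_def)
qed

text \<open>Multiplying a linear relation by \<open>d\<close> isolates the coefficient of
  \<open>d\<close>. The bound permits the choice of a decomposition of maximal size.\<close>

lemma orth_idempotents_card_le:
  assumes S: "orth_idempotents S"
  shows "card S \<le> DIM('a)"
proof -
  have "independent S"
  proof (rule independent_if_scalars_zero)
    fix f d assume "(\<Sum>c\<in>S. f c *\<^sub>R c) = 0" "d \<in> S"
    then have "f d *\<^sub>R d = 0" using orth_sum_mult[OF S, of d f] by simp
    then show "f d = 0" using S \<open>d \<in> S\<close> by (auto simp: orth_idempotents_def)
  qed (use S in \<open>simp add: orth_idempotents_def\<close>)
  then show ?thesis using independent_bound by blast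
qed

lemma orth_sum_product:
  assumes S: "orth_idempotents S"
  shows "(\<Sum>c\<in>S. l c *\<^sub>R c) \<odot> (\<Sum>c\<in>S. m c *\<^sub>R c) = (\<Sum>c\<in>S. (l c * m c) *\<^sub>R c)"
proof -
  have "(\<Sum>c\<in>S. l c *\<^sub>R c) \<odot> (\<Sum>c\<in>S. m c *\<^sub>R c) = (\<Sum>d\<in>S. m d *\<^sub>R ((\<Sum>c\<in>S. l c *\<^sub>R c) \<odot> d))"
    by (simp add: jp_sum_right jp_expand)
  also have "\<dots> = (\<Sum>d\<in>S. (l d * m d) *\<^sub>R d)"
    by (intro sum.cong) (simp_all add: orth_sum_mult[OF S] mult.commute)
  finally show ?thesis .
qed

text \<open>Idempotents from \<open>powers_span x\<close> need not add up to \<open>e\<close>. The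
  remainder \<open>u\<close> is idempotent and orthogonal to them; if nonzero, it joins them with
  eigenvalue \<open>0\<close>.\<close>

lemma spectral_theorem_unit:
  "\<exists>S l. orth_idempotents S \<and> \<Sum>S = e \<and> x = (\<Sum>c\<in>S. l c *\<^sub>R c)"
proof -
  obtain S l where S: "orth_idempotents S" "x = (\<Sum>c\<in>S. l c *\<^sub>R c)"
    using spectral_theorem_powers by blast
  have fin: "finite S" using S(1) by (simp add: orth_idempotents_def)
  define u where "u = e - \<Sum>S"
  have Sd: "\<Sum>S \<odot> d = d" if "d \<in> S" for d
    using orth_sum_mult[OF S(1) that, of "\<lambda>_. 1"] by simp
  have SS: "\<Sum>S \<odot> \<Sum>S = \<Sum>S"
    using orth_sum_product[OF S(1), of "\<lambda>_. 1" "\<lambda>_. 1"] by simp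
  show ?thesis
  proof (cases "u = 0")
    case True
    then show ?thesis using S by (auto simp: u_def)
  next
    case False
    have uu: "u \<odot> u = u" by (simp add: u_def jp_expand SS unit)
    have ud: "u \<odot> d = 0" "d \<odot> u = 0" if "d \<in> S" for d
      using Sd[OF that] commute[of d] by (simp_all add: u_def jp_expand unit)
    have uS: "u \<notin> S" using ud uu False by metis
    have "orth_idempotents (insert u S)"
      using S(1) uu ud False by (auto simp: orth_idempotents_def)
    moreover have "\<Sum>(insert u S) = e" using fin uS by (simp add: u_def)
    moreover have "x = (\<Sum>c\<in>insert u S. (l(u := 0)) c *\<^sub>R c)"
    proof -
      have "(\<Sum>c\<in>insert u S. (l(u := 0)) c *\<^sub>R c) = (\<Sum>c\<in>S. (l(u := 0)) c *\<^sub>R c)"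
        using fin uS by simp
      also have "\<dots> = (\<Sum>c\<in>S. l c *\<^sub>R c)" using uS by (intro sum.cong) auto
      finally show ?thesis using S(2) by simp
    qed
    ultimately show ?thesis by blast
  qed
qed

text \<open>A Jordan frame as a set of unprescribed size; that this size is
  \<open>jrank jp e\<close> is the content of \<open>jrank_eq_card\<close>.\<close>

definition primitive_frame :: "'a set \<Rightarrow> bool" where
  "primitive_frame S \<longleftrightarrow> orth_idempotents S \<and> (\<forall>c\<in>S. primitive_idempotent jp c) \<and> \<Sum>S = e"

text \<open>A decomposition with the largest number of idempotents consists of primitive ones.\<close>

lemma spectral_theorem:
  "\<exists>S l. primitive_frame S \<and> x = (\<Sum>c\<in>S. l c *\<^sub>R c)"
proof -
  define D where "D S \<longleftrightarrow> orth_idempotents S \<and> \<Sum>S = e \<and> (\<exists>l. x = (\<Sum>c\<in>S. l c *\<^sub>R c))" for S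
  obtain S0 where "D S0" using spectral_theorem_unit unfolding D_def by blast
  moreover have "\<forall>S. D S \<longrightarrow> card S < Suc DIM('a)"
    using orth_idempotents_card_le unfolding D_def less_Suc_eq_le by blast
  ultimately have "\<exists>S. D S \<and> (\<forall>S'. D S' \<longrightarrow> card S' \<le> card S)"
    by (rule ex_has_greatest_nat)
  then obtain S where S: "D S" "\<And>S'. D S' \<Longrightarrow> card S' \<le> card S" by blast
  then obtain l where o: "orth_idempotents S" and se: "\<Sum>S = e" and l: "x = (\<Sum>c\<in>S. l c *\<^sub>R c)"
    by (auto simp: D_def)
  have fin: "finite S" using o by (simp add: orth_idempotents_def)
  have "primitive_idempotent jp c" if cS: "c \<in> S" for c
  proof (rule ccontr)
    assume np: "\<not> primitive_idempotent jp c"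
    have c: "c \<odot> c = c" "c \<noteq> 0" using o cS by (auto simp: orth_idempotents_def)
    then obtain a b where ab: "a \<odot> a = a" "b \<odot> b = b" "a \<noteq> 0" "b \<noteq> 0" "c = a + b"
      using np by (auto simp: primitive_idempotent_def idempotent_def)
    have orth: "a \<odot> b = 0" using idempotents_sum_orth ab c by blast
    then have orth': "b \<odot> a = 0" by (simp add: commute)
    let ?R = "S - {c}"
    have aR: "a \<odot> d = 0" "b \<odot> d = 0" if "d \<in> ?R" for d
    proof -
      have "c \<odot> d = 0" using o cS that by (auto simp: orth_idempotents_def)
      then show "a \<odot> d = 0" "b \<odot> d = 0"
        using orth_summand[of a b d] orth_summand[of b a d] ab by (simp_all add: add.commute)
    qed
    have aR': "d \<odot> a = 0" "d \<odot> b = 0" if "d \<in> ?R" for d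
      using aR[OF that] by (simp_all add: commute)
    have "a \<notin> ?R" "b \<notin> ?R" "a \<noteq> b" using aR ab orth by metis+
    then have nin: "a \<notin> insert b ?R" "b \<notin> ?R" by auto
    define S' where "S' = insert a (insert b ?R)"
    \<comment> \<open>Both pieces of \<open>c\<close> inherit its eigenvalue, so the split leaves
      \<open>x\<close> unchanged.\<close>
    define l' where "l' = (\<lambda>d. if d = a \<or> d = b then l c else l d)"
    have sum': "(\<Sum>d\<in>S'. f d) = f a + (f b + (\<Sum>d\<in>?R. f d))" for f :: "'a \<Rightarrow> 'a"
      unfolding S'_def using nin fin by simp
    have sumS: "(\<Sum>d\<in>S. f d) = f c + (\<Sum>d\<in>?R. f d)" for f :: "'a \<Rightarrow> 'a"
      using fin cS by (rule sum.remove)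
    have "orth_idempotents S'"
      using o ab orth orth' aR aR' unfolding orth_idempotents_def S'_def by auto
    moreover have "\<Sum>S' = e" using sum'[of "\<lambda>d. d"] sumS[of "\<lambda>d. d"] se ab(5) by (simp add: add.assoc)
    moreover have "x = (\<Sum>d\<in>S'. l' d *\<^sub>R d)"
    proof -
      have "(\<Sum>d\<in>?R. l' d *\<^sub>R d) = (\<Sum>d\<in>?R. l d *\<^sub>R d)"
        using nin by (intro sum.cong) (auto simp: l'_def)
      then have "(\<Sum>d\<in>S'. l' d *\<^sub>R d) = l c *\<^sub>R c + (\<Sum>d\<in>?R. l d *\<^sub>R d)"
        unfolding sum' by (simp add: l'_def ab(5) scaleR_add_right)
      then show ?thesis unfolding l sumS by simp
    qed
    ultimately have "D S'" unfolding D_def by (intro conjI exI[of _ l'])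
    then have "card S' \<le> card S" by (rule S(2))
    moreover have "card S' = Suc (card S)"
      unfolding S'_def card_Suc_Diff1[OF fin cS, symmetric] using nin fin
      by (simp del: card_Diff_singleton)
    ultimately show False by simp
  qed
  then show ?thesis using o se l unfolding primitive_frame_def by blast
qed

section \<open>Primitive idempotents and the trace functional\<close>

text \<open>Every idempotent \<open>d\<close> in the decomposition of \<open>y\<close> satisfies
  \<open>c \<odot> d = d\<close>, so \<open>c = d + (c - d)\<close> is a sum of idempotents.
  Primitivity forces \<open>d = c\<close>.\<close>

lemma primitive_peirce_one:
  assumes c: "primitive_idempotent jp c" and y: "c \<odot> y = y"
  shows "\<exists>t. y = t *\<^sub>R c"
proof -
  have cc: "c \<odot> c = c" using c by (simp add: primitive_idempotent_def idempotent_def)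
  obtain S l where S: "orth_idempotents S" "S \<subseteq> powers_span y" "y = (\<Sum>d\<in>S. l d *\<^sub>R d)"
    using spectral_theorem_powers by blast
  have "d = c" if "d \<in> S" for d
  proof (rule ccontr)
    assume "d \<noteq> c"
    have d: "d \<odot> d = d" "d \<noteq> 0" using S(1) that by (auto simp: orth_idempotents_def)
    have cd: "c \<odot> d = d" using powers_span_peirce_one[OF cc y] S(2) that by blast
    have "(c - d) \<odot> (c - d) = c - d" by (simp add: jp_expand cc d cd commute[of d c])
    moreover have "c = d + (c - d)" by simp
    ultimately show False
      using c d \<open>d \<noteq> c\<close> unfolding primitive_idempotent_def idempotent_def
      by (metis eq_iff_diff_eq_0)
  qed
  then have "y = (\<Sum>d\<in>S. l d *\<^sub>R c)" using S(3) by (metis (no_types, lifting) sum.cong)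
  then show ?thesis by (metis scaleR_left.sum)
qed

text \<open>With \<open>L\<close> for multiplication by \<open>c\<close>, the Peirce polynomial says
  that \<open>L\<close> fixes the image of \<open>2 L\<^sup>2 - L\<close>, and
  \<open>primitive_peirce_one\<close> applies.\<close>

lemma primitive_quadratic:
  assumes c: "primitive_idempotent jp c"
  shows "\<exists>t. 2 *\<^sub>R (c \<odot> (c \<odot> v)) - c \<odot> v = t *\<^sub>R c"
proof (rule primitive_peirce_one[OF c])
  have "c \<odot> c = c" using c by (simp add: primitive_idempotent_def idempotent_def)
  then have "2 *\<^sub>R (c \<odot> (c \<odot> (c \<odot> v))) = 3 *\<^sub>R (c \<odot> (c \<odot> v)) - c \<odot> v" by (rule idempotent_peirce)
  moreover have "3 *\<^sub>R w = 2 *\<^sub>R w + w" for w :: 'a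
    using scaleR_left_distrib[of 2 1 w] by simp
  ultimately show "c \<odot> (2 *\<^sub>R (c \<odot> (c \<odot> v)) - c \<odot> v) = 2 *\<^sub>R (c \<odot> (c \<odot> v)) - c \<odot> v"
    by (simp add: jp_expand)
qed

text \<open>With \<open>w = c d\<close>, evaluating \<open>B w w\<close> through \<open>c\<close> and through \<open>d\<close> compares the coefficients of
  \<open>c\<close> and \<open>d\<close> in \<open>2 c w - w\<close> and \<open>2 d w - w\<close>.\<close>

lemma primitive_form_eq:
  assumes c: "primitive_idempotent jp c" and d: "primitive_idempotent jp d" and cd: "B c d \<noteq> 0"
  shows "B c c = B d d"
proof -
  define w where "w = c \<odot> d"
  have w': "w = d \<odot> c" by (simp add: w_def commute)
  have cc: "c \<odot> c = c" and dd: "d \<odot> d = d" using c d by (simp_all add: primitive_idempotent_def idempotent_def)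
  obtain t where t: "2 *\<^sub>R (c \<odot> w) - w = t *\<^sub>R c" using primitive_quadratic[OF c, of d] by (auto simp: w_def)
  obtain s where s: "2 *\<^sub>R (d \<odot> w) - w = s *\<^sub>R d" using primitive_quadratic[OF d, of c] by (auto simp: w')
  have wd: "B w d = B c d" and wc: "B w c = B c d"
    using B_assoc[of c d d] B_assoc[of d c c] form_sym[of c d] by (simp_all add: dd cc w_def w' commute)
  have cw: "B (c \<odot> w) d = B w w" "B (d \<odot> w) c = B w w"
    using self_adjoint[of c w d] self_adjoint[of d w c] by (simp_all add: w_def w' commute)
  have cwc: "B (c \<odot> w) c = B c d" "B (d \<odot> w) d = B c d"
    using self_adjoint[of c w c] self_adjoint[of d w d] by (simp_all add: cc dd wc wd)
  have "2 * B w w - B c d = t * B c d" "2 * B w w - B c d = s * B c d"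
    using arg_cong[OF t, of "\<lambda>u. B u d"] arg_cong[OF s, of "\<lambda>u. B u c"] form_sym[of d c]
    by (simp_all add: form_expand cw wd wc)
  then have ts: "t = s" using cd by simp
  have "B c d = t * B c c" "B c d = s * B d d"
    using arg_cong[OF t, of "\<lambda>u. B u c"] arg_cong[OF s, of "\<lambda>u. B u d"]
    by (simp_all add: form_expand cwc wd wc)
  then show ?thesis using ts cd by auto
qed

lemma trace_functional:
  obtains T :: "'a \<Rightarrow> real" where "linear T" "\<And>c. primitive_idempotent jp c \<Longrightarrow> T c = 1"
proof -
  obtain F where F: "primitive_frame F" using spectral_theorem by blast
  define T where "T x = (\<Sum>f\<in>F. B x f / B f f)" for x
  have "linear T"
    by (rule linearI) (simp_all add: T_def form_expand add_divide_distrib sum.distrib sum_distrib_left)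
  moreover have "T c = 1" if c: "primitive_idempotent jp c" for c
  proof -
    have "T c = (\<Sum>f\<in>F. B c f / B c c)"
      unfolding T_def
    proof (intro sum.cong)
      fix f assume "f \<in> F"
      then have "primitive_idempotent jp f" using F by (simp add: primitive_frame_def)
      then show "B c f / B f f = B c f / B c c" using primitive_form_eq[OF c] by (cases "B c f = 0") auto
    qed simp
    also have "\<dots> = B c (\<Sum>F) / B c c" by (simp add: form_sum_right sum_divide_distrib)
    \<comment> \<open>The frame sums to \<open>e\<close>, and associativity gives
      \<open>B c e = B (c \<odot> c) e = B c c\<close>.\<close>
    also have "B c (\<Sum>F) = B c c"
      using F B_assoc[of c c e] c by (simp add: primitive_frame_def primitive_idempotent_def idempotent_def unit)
    finally show ?thesis using c by (simp add: primitive_idempotent_def)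
  qed
  ultimately show ?thesis using that by blast
qed

lemma primitive_frame_card_unique:
  assumes "primitive_frame S" "primitive_frame S'"
  shows "card S = card S'"
proof -
  obtain T :: "'a \<Rightarrow> real" where T: "linear T" "\<And>c. primitive_idempotent jp c \<Longrightarrow> T c = 1"
    using trace_functional by blast
  have "real (card S) = T e" if "primitive_frame S" for S
  proof -
    have "T e = (\<Sum>c\<in>S. T c)" using that T(1) linear_sum by (fastforce simp: primitive_frame_def)
    also have "\<dots> = (\<Sum>c\<in>S. 1)" using that T(2) by (intro sum.cong) (auto simp: primitive_frame_def)
    finally show ?thesis by simp
  qed
  then show ?thesis using assms by (metis of_nat_eq_iff)
qed

section \<open>Rank as the size of a frame\<close>

lemma orth_sum_jpow:
  assumes S: "orth_idempotents S" "\<Sum>S = e"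
  shows "jpow jp e (\<Sum>c\<in>S. l c *\<^sub>R c) k = (\<Sum>c\<in>S. (l c ^ k) *\<^sub>R c)"
  by (induction k) (simp_all add: S orth_sum_product)

text \<open>Upper bound: the polynomial with the eigenvalues of \<open>x\<close> as roots
  annihilates \<open>x\<close>, and its degree is the common size of all frames. Lower bound: for an
  element with distinct eigenvalues on \<open>S\<close>, a dependence among the powers up to
  \<open>r\<close> is a nonzero polynomial of degree at most \<open>r\<close> with
  \<open>card S\<close> roots.\<close>

lemma jrank_eq_card:
  assumes "primitive_frame S"
  shows "jrank jp e = card S"
  unfolding jrank_def
proof (rule Least_equality)
  show "\<forall>x. \<exists>a :: nat \<Rightarrow> real. (\<exists>k\<le>card S. a k \<noteq> 0) \<and> (\<Sum>k\<le>card S. a k *\<^sub>R jpow jp e x k) = 0"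
  proof
    fix x
    obtain R l where R: "primitive_frame R" and x: "x = (\<Sum>c\<in>R. l c *\<^sub>R c)"
      using spectral_theorem by blast
    have o: "orth_idempotents R" "\<Sum>R = e" and fin: "finite R"
      using R by (auto simp: primitive_frame_def orth_idempotents_def)
    define p where "p = (\<Prod>c\<in>R. [:- l c, 1:])"
    have deg: "degree p = card S"
      unfolding p_def primitive_frame_card_unique[OF assms R] by (subst degree_prod_eq_sum_degree) auto
    have "p \<noteq> 0" using fin by (simp add: p_def)
    then have "coeff p (card S) \<noteq> 0" using deg by (metis leading_coeff_0_iff)
    moreover have "(\<Sum>k\<le>card S. coeff p k *\<^sub>R jpow jp e x k) = 0"
    proof -
      have "(\<Sum>k\<le>card S. coeff p k *\<^sub>R jpow jp e x k) = (\<Sum>k\<le>card S. \<Sum>c\<in>R. (coeff p k * l c ^ k) *\<^sub>R c)"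
        by (simp add: x orth_sum_jpow[OF o] scaleR_sum_right)
      also have "\<dots> = (\<Sum>c\<in>R. poly p (l c) *\<^sub>R c)"
        unfolding poly_altdef deg scaleR_left.sum by (rule sum.swap)
      also have "\<dots> = 0" using fin by (intro sum.neutral) (auto simp: p_def poly_prod prod_zero_iff)
      finally show ?thesis .
    qed
    ultimately show "\<exists>a :: nat \<Rightarrow> real. (\<exists>k\<le>card S. a k \<noteq> 0) \<and>
        (\<Sum>k\<le>card S. a k *\<^sub>R jpow jp e x k) = 0" by blast
  qed
next
  fix r assume r: "\<forall>x. \<exists>a :: nat \<Rightarrow> real. (\<exists>k\<le>r. a k \<noteq> 0) \<and> (\<Sum>k\<le>r. a k *\<^sub>R jpow jp e x k) = 0"
  have o: "orth_idempotents S" "\<Sum>S = e" and fin: "finite S"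
    using assms by (auto simp: primitive_frame_def orth_idempotents_def)
  obtain f :: "'a \<Rightarrow> nat" where f: "inj_on f S" using finite_imp_inj_to_nat_seg[OF fin] by blast
  define x where "x = (\<Sum>c\<in>S. real (f c) *\<^sub>R c)"
  obtain a where a: "\<exists>k\<le>r. a k \<noteq> 0" "(\<Sum>k\<le>r. a k *\<^sub>R jpow jp e x k) = 0" using r by blast
  define p where "p = (\<Sum>k\<le>r. monom (a k) k)"
  have co: "coeff p k = (if k \<le> r then a k else 0)" for k
    by (simp add: p_def coeff_sum)
  have deg: "degree p \<le> r" by (rule degree_le) (simp add: co)
  have nz: "p \<noteq> 0" using a(1) co by (metis coeff_0)
  have root: "poly p (real (f d)) = 0" if d: "d \<in> S" for d
  proof -
    have "jpow jp e x k \<odot> d = real (f d) ^ k *\<^sub>R d" for k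
      unfolding x_def orth_sum_jpow[OF o] by (rule orth_sum_mult[OF o(1) d])
    then have "(\<Sum>k\<le>r. a k *\<^sub>R jpow jp e x k) \<odot> d = (\<Sum>k\<le>r. (a k * real (f d) ^ k) *\<^sub>R d)"
      by (simp add: jp_sum_left jp_scale_left)
    also have "\<dots> = poly p (real (f d)) *\<^sub>R d"
      by (simp add: p_def poly_sum poly_monom scaleR_left.sum)
    finally show ?thesis using a(2) o(1) d by (auto simp: orth_idempotents_def)
  qed
  have "card S = card ((\<lambda>c. real (f c)) ` S)"
    using f by (intro card_image[symmetric]) (auto simp: inj_on_def)
  also have "\<dots> \<le> card {t. poly p t = 0}"
    using root by (intro card_mono poly_roots_finite nz) auto
  also have "\<dots> \<le> r" using card_poly_roots_bound[OF nz] deg by (meson order_trans)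
  finally show "card S \<le> r" .
qed

section \<open>Trace form and cone of squares\<close>

lemma jordan_frame_of_primitive_frame:
  assumes S: "primitive_frame S" and c: "bij_betw c {..<card S} S"
  shows "jordan_frame jp e c"
  unfolding jordan_frame_def jrank_eq_card[OF S]
proof (intro conjI allI impI)
  have mem: "c i \<in> S" if "i < card S" for i using c that by (auto simp: bij_betw_def)
  show "primitive_idempotent jp (c i)" if "i < card S" for i
    using S mem[OF that] by (simp add: primitive_frame_def)
  show "c i \<odot> c j = 0" if "i < card S" "j < card S" "i \<noteq> j" for i j
  proof -
    have "c i \<noteq> c j" using c that by (auto simp: bij_betw_def inj_on_def)
    then show ?thesis using S mem that by (simp add: primitive_frame_def orth_idempotents_def)
  qed
  show "(\<Sum>i<card S. c i) = e"
    using S sum.reindex_bij_betw[OF c, of "\<lambda>d. d"] by (simp add: primitive_frame_def)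
qed

lemma eigenvalues_decomposition:
  obtains c where "spectral_decomposition jp e x (eigenvalues jp e x) c"
proof -
  obtain S l where S: "primitive_frame S" and x: "x = (\<Sum>c\<in>S. l c *\<^sub>R c)"
    using spectral_theorem by blast
  have "finite S" using S by (simp add: primitive_frame_def orth_idempotents_def)
  then obtain c where c: "bij_betw c {..<card S} S"
    using ex_bij_betw_nat_finite by (auto simp: atLeast0LessThan)
  have "x = (\<Sum>i<card S. l (c i) *\<^sub>R c i)"
    unfolding x by (rule sum.reindex_bij_betw[OF c, symmetric])
  then have "spectral_decomposition jp e x (\<lambda>i. l (c i)) c"
    unfolding spectral_decomposition_def jrank_eq_card[OF S]
    using jordan_frame_of_primitive_frame[OF S c] by blast
  then have "\<exists>c. spectral_decomposition jp e x (eigenvalues jp e x) c"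
    unfolding eigenvalues_def by (rule someI[where P = "\<lambda>l. \<exists>c. spectral_decomposition jp e x l c", OF exI])
  then show ?thesis using that by blast
qed

text \<open>On every spectral decomposition the linear functional \<open>T\<close> of
  \<open>trace_functional\<close> equals the sum of the coefficients, so \<open>jtrace jp e\<close>
  is \<open>T\<close>. Linearity and independence of the chosen eigenvalues follow together.\<close>

lemma jtrace_linear_and_value:
  "linear (jtrace jp e) \<and> (\<forall>x l c. spectral_decomposition jp e x l c \<longrightarrow> jtrace jp e x = (\<Sum>i<jrank jp e. l i))"
proof -
  obtain T :: "'a \<Rightarrow> real" where T: "linear T" "\<And>c. primitive_idempotent jp c \<Longrightarrow> T c = 1"
    using trace_functional by blast
  have val: "T x = (\<Sum>i<jrank jp e. l i)" if "spectral_decomposition jp e x l c" for x l c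
  proof -
    have x: "x = (\<Sum>i<jrank jp e. l i *\<^sub>R c i)"
      and "\<forall>i<jrank jp e. T (c i) = 1"
      using that T(2) by (auto simp: spectral_decomposition_def jordan_frame_def)
    then show ?thesis
      unfolding x linear_sum[OF T(1)] by (intro sum.cong) (simp_all add: linear_cmul[OF T(1)])
  qed
  have "jtrace jp e x = T x" for x
    using eigenvalues_decomposition[of x] val by (metis jtrace_def)
  then have "jtrace jp e = T" by blast
  then show ?thesis using T(1) val by blast
qed

lemmas linear_jtrace = jtrace_linear_and_value[THEN conjunct1]

lemma jtrace_spectral: "spectral_decomposition jp e x l c \<Longrightarrow> jtrace jp e x = (\<Sum>i<jrank jp e. l i)"
  using jtrace_linear_and_value by blast

lemma decomposition_mult_frame:
  assumes "spectral_decomposition jp e x l c" "i < jrank jp e"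
  shows "x \<odot> c i = l i *\<^sub>R c i"
proof -
  have x: "x = (\<Sum>j<jrank jp e. l j *\<^sub>R c j)" and fr: "jordan_frame jp e c"
    using assms(1) by (auto simp: spectral_decomposition_def)
  have "x \<odot> c i = (\<Sum>j<jrank jp e. if j = i then l i *\<^sub>R c i else 0)"
    unfolding x jp_sum_left using fr assms(2)
    by (intro sum.cong)
      (auto simp: jordan_frame_def primitive_idempotent_def idempotent_def jp_scale_left)
  then show ?thesis using assms(2) by simp
qed

lemma decomposition_square:
  assumes d: "spectral_decomposition jp e x l c"
  shows "spectral_decomposition jp e (x \<odot> x) (\<lambda>i. (l i)\<^sup>2) c"
proof -
  have x: "x = (\<Sum>j<jrank jp e. l j *\<^sub>R c j)" and fr: "jordan_frame jp e c"
    using d by (auto simp: spectral_decomposition_def)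
  have "x \<odot> (\<Sum>j<jrank jp e. l j *\<^sub>R c j) = (\<Sum>j<jrank jp e. (l j)\<^sup>2 *\<^sub>R c j)"
    unfolding jp_sum_right
    by (intro sum.cong) (simp_all add: jp_scale_right decomposition_mult_frame[OF d] power2_eq_square)
  then show ?thesis using fr x unfolding spectral_decomposition_def by metis
qed

lemma jinner_self: "jinner jp e x x = (\<Sum>i<jrank jp e. (eigenvalues jp e x i)\<^sup>2)"
  unfolding jinner_def
  using eigenvalues_decomposition[of x] decomposition_square jtrace_spectral by metis

lemma jinner_unit: "jinner jp e e x = (\<Sum>i<jrank jp e. eigenvalues jp e x i)"
  by (simp add: jinner_def jtrace_def)

lemma inner_form_jinner: "inner_form (jinner jp e)"
proof
  show "bilinear (jinner jp e)"
    unfolding bilinear_def jinner_def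
    by (intro conjI allI linearI)
      (simp_all add: jp_expand linear_add[OF linear_jtrace] linear_cmul[OF linear_jtrace])
  show "jinner jp e x y = jinner jp e y x" for x y
    by (simp add: jinner_def commute)
  show "0 < jinner jp e x x" if "x \<noteq> 0" for x
  proof (rule ccontr)
    assume "\<not> 0 < jinner jp e x x"
    then have "(\<Sum>i<jrank jp e. (eigenvalues jp e x i)\<^sup>2) = 0"
      by (simp add: jinner_self not_less sum_nonneg order_antisym)
    then have "\<forall>i<jrank jp e. eigenvalues jp e x i = 0"
      by (simp add: sum_nonneg_eq_0_iff)
    moreover obtain c where "spectral_decomposition jp e x (eigenvalues jp e x) c"
      by (rule eigenvalues_decomposition)
    ultimately show False using that by (simp add: spectral_decomposition_def)
  qed
qed

section \<open>The cone of squares and its nearest points\<close>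

text \<open>Inequalities linear in \<open>x\<close> make closedness and convexity of the cone
  immediate. For the converse, testing on frame elements shows the eigenvalues to be nonnegative,
  and their square roots on the same frame give \<open>y\<close>.\<close>

lemma squares_iff: "x \<in> {y \<odot> y | y. True} \<longleftrightarrow> (\<forall>v. 0 \<le> B (x \<odot> v) v)"
proof
  assume "x \<in> {y \<odot> y | y. True}"
  then obtain y where y: "x = y \<odot> y" by blast
  obtain S l where S: "primitive_frame S" and yS: "y = (\<Sum>c\<in>S. l c *\<^sub>R c)"
    using spectral_theorem by blast
  have o: "orth_idempotents S" using S by (simp add: primitive_frame_def)
  have x: "x = (\<Sum>c\<in>S. (l c * l c) *\<^sub>R c)" unfolding y yS by (rule orth_sum_product[OF o])
  show "\<forall>v. 0 \<le> B (x \<odot> v) v"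
    unfolding x jp_sum_left form_sum_left jp_scale_left form_scale_left
  proof (intro allI sum_nonneg)
    fix v c assume "c \<in> S"
    then have "0 \<le> B (c \<odot> v) v"
      using o by (intro idempotent_form_nonneg) (simp add: orth_idempotents_def)
    then show "0 \<le> l c * l c * B (c \<odot> v) v" by simp
  qed
next
  assume pos: "\<forall>v. 0 \<le> B (x \<odot> v) v"
  obtain S l where S: "primitive_frame S" and x: "x = (\<Sum>c\<in>S. l c *\<^sub>R c)"
    using spectral_theorem by blast
  have o: "orth_idempotents S" using S by (simp add: primitive_frame_def)
  have nn: "0 \<le> l c" if "c \<in> S" for c
  proof -
    have "0 \<le> l c * B c c" using pos orth_sum_mult[OF o that, of l] x by (metis form_scale_left)
    moreover have "0 < B c c" using o that by (intro form_pos) (simp add: orth_idempotents_def)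
    ultimately show ?thesis by (simp add: zero_le_mult_iff)
  qed
  define y where "y = (\<Sum>c\<in>S. sqrt (l c) *\<^sub>R c)"
  have "y \<odot> y = (\<Sum>c\<in>S. (sqrt (l c) * sqrt (l c)) *\<^sub>R c)"
    unfolding y_def by (rule orth_sum_product[OF o])
  also have "\<dots> = x" unfolding x by (intro sum.cong) (simp_all add: nn)
  finally have "x = y \<odot> y" ..
  then show "x \<in> {y \<odot> y | y. True}" by blast
qed

lemma squares_eq: "{y \<odot> y | y. True} = {x. \<forall>v. 0 \<le> B (x \<odot> v) v}"
  using squares_iff by blast

lemma closed_squares: "closed {y \<odot> y | y. True}"
proof -
  have "continuous_on UNIV (\<lambda>x. x \<odot> v)" for v
    using bilinear unfolding bilinear_conv_bounded_bilinear
    by (rule bounded_bilinear.continuous_on) (intro continuous_intros)+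
  then show ?thesis
    unfolding squares_eq by (intro closed_Collect_all closed_Collect_le continuous_intros) auto
qed

lemma convex_squares: "convex {y \<odot> y | y. True}"
  unfolding squares_eq by (auto simp: convex_def jp_expand form_expand)

lemma squares_scale: "0 \<le> s \<Longrightarrow> x \<in> {y \<odot> y | y. True} \<Longrightarrow> s *\<^sub>R x \<in> {y \<odot> y | y. True}"
  unfolding squares_eq by (simp add: jp_expand form_expand)

lemma eigenvalues_nonneg:
  assumes x: "x \<in> {y \<odot> y | y. True}" and i: "i < jrank jp e"
  shows "0 \<le> eigenvalues jp e x i"
proof -
  obtain c where c: "spectral_decomposition jp e x (eigenvalues jp e x) c"
    by (rule eigenvalues_decomposition)
  have "c i \<noteq> 0"
    using c i by (simp add: spectral_decomposition_def jordan_frame_def primitive_idempotent_def)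
  then have "0 < B (c i) (c i)" by (rule form_pos)
  moreover have "0 \<le> B (x \<odot> c i) (c i)" using x unfolding squares_eq by blast
  ultimately show ?thesis
    by (simp add: decomposition_mult_frame[OF c i] form_scale_left zero_le_mult_iff)
qed

lemma jrank_pos: "0 < jrank jp e"
proof (rule ccontr)
  assume r: "\<not> 0 < jrank jp e"
  have "x = 0" for x :: 'a
  proof -
    obtain c where "spectral_decomposition jp e x (eigenvalues jp e x) c"
      by (rule eigenvalues_decomposition)
    then show ?thesis using r by (simp add: spectral_decomposition_def)
  qed
  moreover obtain b :: 'a where "b \<in> Basis" using nonempty_Basis by blast
  ultimately show False using nonzero_Basis by blast
qed

lemma spectral_norm_ge:
  assumes "jinner jp e e x = 1"
  shows "1 / real (jrank jp e) \<le> spectral_norm jp e x"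
proof -
  let ?r = "jrank jp e"
  have "1 = (\<Sum>i<?r. eigenvalues jp e x i)" using assms by (simp add: jinner_unit)
  also have "\<dots> \<le> (\<Sum>i<?r. spectral_norm jp e x)"
  proof (rule sum_mono)
    fix i assume "i \<in> {..<?r}"
    then have "\<bar>eigenvalues jp e x i\<bar> \<le> spectral_norm jp e x"
      unfolding spectral_norm_def by (intro Max_ge) auto
    then show "eigenvalues jp e x i \<le> spectral_norm jp e x" by simp
  qed
  finally show ?thesis using jrank_pos by (simp add: divide_le_eq mult.commute)
qed

text \<open>The eigenvalues are nonnegative with sum one, so each is at least its own
  square.\<close>

lemma jinner_self_le_one:
  assumes "x \<in> {y \<odot> y | y. True}" "jinner jp e e x = 1"
  shows "jinner jp e x x \<le> 1"
proof -
  let ?r = "jrank jp e" and ?l = "eigenvalues jp e x"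
  have s: "(\<Sum>i<?r. ?l i) = 1" using assms(2) by (simp add: jinner_unit)
  have "(\<Sum>i<?r. (?l i)\<^sup>2) \<le> (\<Sum>i<?r. ?l i)"
  proof (rule sum_mono)
    fix i assume i: "i \<in> {..<?r}"
    have "?l i \<le> (\<Sum>i<?r. ?l i)"
      by (rule member_le_sum[OF i]) (use eigenvalues_nonneg[OF assms(1)] in auto)
    then show "(?l i)\<^sup>2 \<le> ?l i"
      using s eigenvalues_nonneg[OF assms(1), of i] i by (simp add: power2_eq_square mult_left_le)
  qed
  then show ?thesis using s by (simp add: jinner_self)
qed

text \<open>A convex set with nonempty interior has the same closure as its interior. Hence
  \<open>pos_part\<close> is the nearest point in the closed cone of squares, and
  \<open>nearest_point_cone_le\<close> applies.\<close>

lemma frob_norm_pos_part_le: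
  assumes "symmetric_cone jp \<noteq> {}"
  shows "frob_norm jp e (pos_part jp e v) \<le> frob_norm jp e v"
proof -
  interpret J: inner_form "jinner jp e" by (rule inner_form_jinner)
  let ?K = "{y \<odot> y | y. True}"
  have K: "closure (symmetric_cone jp) = ?K"
    using assms convex_closure_interior[OF convex_squares] closed_squares
    by (simp add: symmetric_cone_def)
  have ne: "?K \<noteq> {}" by blast
  define near where "near w \<longleftrightarrow> w \<in> ?K \<and>
    (\<forall>y\<in>?K. jinner jp e (v - w) (v - w) \<le> jinner jp e (v - y) (v - y))" for w
  have pp: "pos_part jp e v = (THE w. near w)"
    unfolding pos_part_def K near_def by (simp only: frob_norm_def real_sqrt_le_iff)
  obtain w where w: "near w"
    using J.nearest_point_exists[OF closed_squares ne, of v] unfolding near_def by blast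
  moreover have "w' = w" if "near w'" for w'
    using J.nearest_point_unique[OF convex_squares, of w' v w] that w unfolding near_def by blast
  ultimately have "near (pos_part jp e v)" unfolding pp by (rule theI)
  then have "jinner jp e (pos_part jp e v) (pos_part jp e v) \<le> jinner jp e v v"
    using J.nearest_point_cone_le[of ?K "pos_part jp e v" v] squares_scale unfolding near_def by blast
  then show ?thesis by (simp add: frob_norm_def)
qed

section \<open>Iteration bounds\<close>

theorem jordan_perceptron:
  assumes P: "is_orthogonal_projection (jinner jp e) L P"
    and run: "perceptron_run (jinner jp e) (spectraplex (jinner jp e) e (symmetric_cone jp))
                P (jordan_stop jp e P) z"
  shows "\<exists>t \<le> 16 * jrank jp e ^ 4. jordan_stop jp e P (z t)"
proof (rule ccontr)
  assume nostop: "\<not> (\<exists>t \<le> 16 * jrank jp e ^ 4. jordan_stop jp e P (z t))"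
  interpret J: inner_form "jinner jp e" by (rule inner_form_jinner)
  let ?r = "real (jrank jp e)" and ?\<Delta> = "spectraplex (jinner jp e) e (symmetric_cone jp)"
  let ?K = "{y \<odot> y | y. True}"
  \<comment> \<open>Chosen so that the inverse of \<open>sqrt t\<close> is the threshold factor
    \<open>1 / (4 * r)\<close> times the lower bound \<open>1 / r\<close> for the spectral
    norm.\<close>
  define t where "t = 16 * jrank jp e ^ 4"
  have r: "0 < ?r" using jrank_pos by simp
  have "z 0 \<in> ?\<Delta>" using run unfolding perceptron_run_def by blast
  \<comment> \<open>The starting point lies in the closure of the cone's interior, so that interior
    is nonempty.\<close>
  then have ne: "symmetric_cone jp \<noteq> {}" by (auto simp: spectraplex_def)
  have sub: "closure (symmetric_cone jp) \<subseteq> ?K"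
    unfolding symmetric_cone_def using closed_squares interior_subset by (rule closure_minimal[rotated])
  have small: "jinner jp e u u \<le> 1" if "u \<in> ?\<Delta>" for u
    using that sub by (intro jinner_self_le_one) (auto simp: spectraplex_def)
  have conv: "convex ?\<Delta>"
  proof -
    have "convex (closure (symmetric_cone jp))"
      unfolding symmetric_cone_def using convex_squares by (intro convex_closure convex_interior)
    moreover have "convex {x. jinner jp e e x = 1}"
      by (auto simp: convex_def J.form_expand)
    ultimately show ?thesis
      unfolding spectraplex_def Collect_conj_eq Collect_mem_eq by (rule convex_Int)
  qed
  have progress: "z t \<in> ?\<Delta>" "(real t)\<^sup>2 * jinner jp e (P (z t)) (P (z t)) \<le> real t"
    using J.perceptron_progress[OF P run small conv, of t] nostop unfolding t_def by auto
  have t: "0 < real t" "real t = (4 * ?r\<^sup>2)\<^sup>2" using r by (simp_all add: t_def power2_eq_square power4_eq_xxxx)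
  have "jinner jp e (P (z t)) (P (z t)) \<le> 1 / real t"
    using progress(2) t(1) by (simp add: power2_eq_square field_simps)
  also have "\<dots> = (1 / (4 * ?r\<^sup>2))\<^sup>2" unfolding t(2) by (simp add: power_divide)
  finally have "frob_norm jp e (P (z t)) \<le> 1 / (4 * ?r\<^sup>2)"
    unfolding frob_norm_def by (intro real_le_lsqrt) auto
  also have "\<dots> = 1 / (4 * ?r) * (1 / ?r)" by (simp add: power2_eq_square)
  also have "\<dots> \<le> 1 / (4 * ?r) * spectral_norm jp e (z t)"
    using spectral_norm_ge[of "z t"] progress(1) by (intro mult_left_mono) (auto simp: spectraplex_def)
  finally have "jordan_stop jp e P (z t)"
    using frob_norm_pos_part_le[OF ne, of "P (z t)"] unfolding jordan_stop_def by linarith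
  then show False using nostop by (simp add: t_def)
qed

end

text \<open>The threshold \<open>1 / (3 * sqrt n)\<close> differs from the one in
  \<open>jordan_stop\<close>, so \<open>perceptron_progress\<close> is applied afresh, directly to
  the coordinate inner product.\<close>

lemma orthant_perceptron:
  fixes L :: "(real ^ 'n) set"
  assumes P: "is_orthogonal_projection (\<bullet>) L P"
    and run: "perceptron_run (\<bullet>) (spectraplex (\<bullet>) 1 pos_orthant) P (orthant_stop P) z"
  shows "\<exists>t \<le> 9 * CARD('n) ^ 3. orthant_stop P (z t)"
proof (rule ccontr)
  assume nostop: "\<not> (\<exists>t \<le> 9 * CARD('n) ^ 3. orthant_stop P (z t))"
  interpret J: inner_form "(\<bullet>) :: real ^ 'n \<Rightarrow> real ^ 'n \<Rightarrow> real"
    by unfold_locales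
      (simp_all add: bilinear_conv_bounded_bilinear bounded_bilinear_inner inner_commute)
  let ?n = "real CARD('n)" and ?\<Delta> = "spectraplex (\<bullet>) 1 (pos_orthant :: (real ^ 'n) set)"
  define t where "t = 9 * CARD('n) ^ 3"
  have \<Delta>: "?\<Delta> = {x. (\<forall>i. 0 \<le> x $ i) \<and> (\<Sum>i\<in>UNIV. x $ i) = 1}"
    by (auto simp: spectraplex_def closure_pos_orthant inner_vec_def)
  have small: "u \<bullet> u \<le> 1" if "u \<in> ?\<Delta>" for u
  proof -
    have u: "\<And>i. 0 \<le> u $ i" "(\<Sum>i\<in>UNIV. u $ i) = 1" using that unfolding \<Delta> by auto
    have "u $ i \<le> 1" for i
      using u member_le_sum[of i UNIV "\<lambda>i. u $ i"] by simp
    then have "(\<Sum>i\<in>UNIV. u $ i * u $ i) \<le> (\<Sum>i\<in>UNIV. u $ i)"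
      using u(1) by (intro sum_mono mult_left_le) auto
    then show ?thesis using u(2) by (simp add: inner_vec_def)
  qed
  have conv: "convex ?\<Delta>"
    unfolding \<Delta> convex_def by (auto simp: sum.distrib sum_distrib_left[symmetric])
  have progress: "z t \<in> ?\<Delta>" "(real t)\<^sup>2 * (P (z t) \<bullet> P (z t)) \<le> real t"
    using J.perceptron_progress[OF P run small conv, of t] nostop unfolding t_def by auto
  have infnorm: "1 / ?n \<le> infnorm (z t)"
  proof -
    have "1 = (\<Sum>i\<in>UNIV. z t $ i)" using progress(1) unfolding \<Delta> by simp
    also have "\<dots> \<le> (\<Sum>i\<in>(UNIV :: 'n set). infnorm (z t))"
      using component_le_infnorm_cart[of "z t"] by (intro sum_mono) (metis abs_le_D1)
    finally show ?thesis by (simp add: divide_le_eq mult.commute)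
  qed
  \<comment> \<open>Here \<open>sqrt t\<close> is the inverse threshold \<open>3 * sqrt n\<close>
    times \<open>n\<close>, the inverse of the lower bound for \<open>infnorm\<close>.\<close>
  have t: "0 < real t" "real t = (3 * sqrt ?n * ?n)\<^sup>2"
    by (simp_all add: t_def power_mult_distrib power3_eq_cube power2_eq_square)
  have "P (z t) \<bullet> P (z t) \<le> 1 / real t"
    using progress(2) t(1) by (simp add: power2_eq_square field_simps)
  also have "\<dots> = (1 / (3 * sqrt ?n * ?n))\<^sup>2" unfolding t(2) by (simp add: power_divide)
  finally have "norm (P (z t)) \<le> 1 / (3 * sqrt ?n * ?n)"
    unfolding norm_eq_sqrt_inner by (intro real_le_lsqrt) auto
  also have "\<dots> = 1 / (3 * sqrt ?n) * (1 / ?n)" by simp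
  also have "\<dots> \<le> 1 / (3 * sqrt ?n) * infnorm (z t)"
    using infnorm by (intro mult_left_mono) auto
  finally have "norm (P (z t)) \<le> 1 / (3 * sqrt ?n) * infnorm (z t)" .
  moreover have "norm (\<chi> i. max (P (z t) $ i) 0) \<le> norm (P (z t))"
    by (rule norm_le_componentwise_cart) (auto simp: max_def)
  ultimately have "orthant_stop P (z t)" unfolding orthant_stop_def by linarith
  then show False using nostop by (simp add: t_def)
qed

theorem corollary1:
  fixes jp :: "'a::euclidean_space \<Rightarrow> 'a \<Rightarrow> 'a" and e :: 'a
  shows "(euclidean_jordan_algebra jp e \<longrightarrow>
           (\<forall>L P z.
              is_orthogonal_projection (jinner jp e) L P \<longrightarrow>
              perceptron_run (jinner jp e) (spectraplex (jinner jp e) e (symmetric_cone jp))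
                P (jordan_stop jp e P) z \<longrightarrow>
              (\<exists>t \<le> 16 * jrank jp e ^ 4. jordan_stop jp e P (z t))))
       \<and> (\<forall>(L :: (real ^ 'n) set) P z.
              is_orthogonal_projection (\<bullet>) L P \<longrightarrow>
              perceptron_run (\<bullet>) (spectraplex (\<bullet>) 1 pos_orthant) P (orthant_stop P) z \<longrightarrow>
              (\<exists>t \<le> 9 * CARD('n) ^ 3. orthant_stop P (z t)))"
proof (intro conjI impI allI)
  fix L P z
  assume "euclidean_jordan_algebra jp e"
    and P: "is_orthogonal_projection (jinner jp e) L P"
    and run: "perceptron_run (jinner jp e) (spectraplex (jinner jp e) e (symmetric_cone jp))
                P (jordan_stop jp e P) z"
  then interpret euclidean_jordan_algebra jp e by simp
  \<comment> \<open>Any associative form serves, since the conclusion does not mention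
    \<open>B\<close>.\<close>
  obtain B :: "'a \<Rightarrow> 'a \<Rightarrow> real" where B: "bilinear B" "\<forall>x. x \<noteq> 0 \<longrightarrow> B x x > 0"
    "\<forall>x y z. B (jp x y) z = B x (jp y z)"
    using form by blast
  interpret form_jordan_algebra jp e B
    by unfold_locales (use B in auto)
  show "\<exists>t \<le> 16 * jrank jp e ^ 4. jordan_stop jp e P (z t)"
    using P run by (rule jordan_perceptron)
qed (rule orthant_perceptron)

end
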